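(* Let $M$ be a connected smooth manifold and let $N\in\Omega^1(M;TM)$ (i.e. a smooth vector bundle endomorphism $N:TM\to TM$ over the identity) be such that $N^2=N$ and $\mathrm{Im}\,N$ is involutive. Then there exists a Lie algebroid structure $(TM,q,[\![\,\cdot\,,\,\cdot\,]\!])$ on the vector bundle $TM$ with anchor map $q=N$ and bracket $$[\![X,Y]\!]=[X,Y]_N+T_N(X,Y)$$ for all vector fields $X,Y$ on $M$.
   Context: A Lie algebroid on $M$ is a triple $(E,q,[\![\cdot,\cdot]\!])$: a vector bundle $E\to M$, a vector bundle map $q:E\to TM$ over the identity (the anchor), and a Lie bracket $[\![\cdot,\cdot]\!]$ on $\Gamma(E)$ satisfying $[\![A,fB]\!]=f[\![A,B]\!]+(qA)(f)\,B$ for all $A,B\in\Gamma(E)$, $f\in C^\infty(M)$. For $N:TM\to TM$ and vector fields $X,Y$, the contracted bracket is $[X,Y]_N=[NX,Y]+[X,NY]-N[X,Y]$, and the Nijenhuis torsion is $T_N(X,Y)=[NX,NY]-N[NX,Y]-N[X,NY]+N^2[X,Y]$. The image of $N$ being involutive means that $[NX,NY]$ is a section of $\mathrm{Im}\,N$ for all vector fields $X,Y$. *)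

theory Defs
  imports "HOL-Analysis.Analysis" "HOL-Library.Function_Algebras"
begin

text \<open>Pointwise real vector space structure on functions: it is the one used on tangent vectors
  (functionals on functions), on sections, and on the coordinate space \<open>nat \<Rightarrow> real\<close>.\<close>

instantiation "fun" :: (type, real_vector) real_vector
begin

definition scaleR_fun :: "real \<Rightarrow> ('a \<Rightarrow> 'b) \<Rightarrow> 'a \<Rightarrow> 'b"
  where "scaleR_fun c f = (\<lambda>x. c *\<^sub>R f x)"

instance
  by standard (auto simp: scaleR_fun_def plus_fun_def scaleR_add_left scaleR_add_right)

end


section \<open>Smooth functions on open subsets of Euclidean space\<close>

text \<open>The space $\mathbf{R}^n$ is the library's \<open>Euclidean_space n\<close>, whose points are the
  \<open>x :: nat \<Rightarrow> real\<close> with \<open>x i = 0\<close> for \<open>i \<ge> n\<close>; \<open>n = 0\<close> is allowed.\<close>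

definition partial :: "nat \<Rightarrow> ((nat \<Rightarrow> real) \<Rightarrow> real) \<Rightarrow> (nat \<Rightarrow> real) \<Rightarrow> real"
  where "partial i f x = deriv (\<lambda>t. f (x(i := t))) (x i)"

text \<open>\<open>Ck n k S f\<close>: all partial derivatives of \<open>f\<close> of order at most \<open>k\<close> exist and are
  continuous on \<open>S\<close>, for \<open>S\<close> open in \<open>Euclidean_space n\<close>.\<close>

primrec Ck :: "nat \<Rightarrow> nat \<Rightarrow> (nat \<Rightarrow> real) set \<Rightarrow> ((nat \<Rightarrow> real) \<Rightarrow> real) \<Rightarrow> bool"
  where
    "Ck n 0 S f \<longleftrightarrow> continuous_on S f"
  | "Ck n (Suc k) S f \<longleftrightarrow> continuous_on S f \<and>
       (\<forall>i<n. (\<forall>x\<in>S. (\<lambda>t. f (x(i := t))) differentiable (at (x i))) \<and> Ck n k S (partial i f))"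

definition Csmooth :: "nat \<Rightarrow> (nat \<Rightarrow> real) set \<Rightarrow> ((nat \<Rightarrow> real) \<Rightarrow> real) \<Rightarrow> bool"
  where "Csmooth n S f \<longleftrightarrow> (\<forall>k. Ck n k S f)"


section \<open>Smooth manifolds\<close>

record 'a manifold =
  mtop :: "'a topology"
  mdim :: nat
  charts :: "('a set \<times> ('a \<Rightarrow> nat \<Rightarrow> real)) set"

text \<open>The atlas need not be maximal; two atlases of the same smooth structure give the same
  smooth functions, tangent vectors and smooth sections.\<close>

definition smooth_manifold :: "'a manifold \<Rightarrow> bool"
  where "smooth_manifold M \<longleftrightarrow>
    Hausdorff_space (mtop M) \<and> second_countable (mtop M) \<and>
    (\<Union>(U, \<phi>)\<in>charts M. U) = topspace (mtop M) \<and>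
    (\<forall>(U, \<phi>)\<in>charts M.
       openin (mtop M) U \<and> openin (Euclidean_space (mdim M)) (\<phi> ` U) \<and>
       homeomorphic_map (subtopology (mtop M) U)
         (subtopology (Euclidean_space (mdim M)) (\<phi> ` U)) \<phi>) \<and>
    (\<forall>(U, \<phi>)\<in>charts M. \<forall>(V, \<psi>)\<in>charts M. \<forall>i<mdim M.
       Csmooth (mdim M) (\<phi> ` (U \<inter> V)) (\<lambda>x. \<psi> (inv_into U \<phi> x) i))"

text \<open>Smoothness of a function on an open set \<open>W\<close>; its values off \<open>W\<close> are irrelevant.\<close>

definition smooth_fun :: "'a manifold \<Rightarrow> 'a set \<Rightarrow> ('a \<Rightarrow> real) \<Rightarrow> bool"
  where "smooth_fun M W f \<longleftrightarrow>
    (\<forall>(U, \<phi>)\<in>charts M. Csmooth (mdim M) (\<phi> ` (U \<inter> W)) (\<lambda>x. f (inv_into U \<phi> x)))"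

definition smooth_near :: "'a manifold \<Rightarrow> 'a \<Rightarrow> ('a \<Rightarrow> real) \<Rightarrow> bool"
  where "smooth_near M p f \<longleftrightarrow> (\<exists>W. openin (mtop M) W \<and> p \<in> W \<and> smooth_fun M W f)"


section \<open>Vector bundles\<close>

text \<open>The fibres are linear subspaces of an ambient real vector space \<open>'v\<close>; the total space is
  their disjoint union \<open>{(p, v). p \<in> M, v \<in> fibre E p}\<close>. Its smooth structure is carried by the
  local trivialisations \<open>(U, \<Phi>)\<close>, where \<open>\<Phi> p\<close> is a linear isomorphism of the fibre over \<open>p\<close>
  with $\mathbf{R}^k$ for every \<open>p \<in> U\<close>, and the transition matrices are smooth.\<close>

record ('a, 'v) vbundle =
  fibre :: "'a \<Rightarrow> 'v set"
  rank :: nat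
  trivs :: "('a set \<times> ('a \<Rightarrow> 'v \<Rightarrow> nat \<Rightarrow> real)) set"

definition linear_between :: "'v::real_vector set \<Rightarrow> 'w::real_vector set \<Rightarrow> ('v \<Rightarrow> 'w) \<Rightarrow> bool"
  where "linear_between V W L \<longleftrightarrow>
    (\<forall>v\<in>V. L v \<in> W) \<and> (\<forall>v\<in>V. \<forall>w\<in>V. L (v + w) = L v + L w) \<and>
    (\<forall>c. \<forall>v\<in>V. L (c *\<^sub>R v) = c *\<^sub>R L v)"

text \<open>The local frame of a trivialisation: \<open>frame E \<Phi> j p\<close> has coordinates the \<open>j\<close>-th standard
  basis vector.\<close>

definition frame ::
  "('a, 'v) vbundle \<Rightarrow> ('a \<Rightarrow> 'v \<Rightarrow> nat \<Rightarrow> real) \<Rightarrow> nat \<Rightarrow> 'a \<Rightarrow> 'v"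
  where "frame E \<Phi> j p = inv_into (fibre E p) (\<Phi> p) (\<lambda>i. if i = j then 1 else 0)"

definition vector_bundle :: "'a manifold \<Rightarrow> ('a, 'v::real_vector) vbundle \<Rightarrow> bool"
  where "vector_bundle M E \<longleftrightarrow>
    smooth_manifold M \<and>
    (\<forall>p\<in>topspace (mtop M). subspace (fibre E p)) \<and>
    (\<Union>(U, \<Phi>)\<in>trivs E. U) = topspace (mtop M) \<and>
    (\<forall>(U, \<Phi>)\<in>trivs E. openin (mtop M) U \<and>
       (\<forall>p\<in>U. linear_between (fibre E p) (topspace (Euclidean_space (rank E))) (\<Phi> p) \<and>
              bij_betw (\<Phi> p) (fibre E p) (topspace (Euclidean_space (rank E))))) \<and>
    (\<forall>(U, \<Phi>)\<in>trivs E. \<forall>(V, \<Psi>)\<in>trivs E. \<forall>i<rank E. \<forall>j<rank E.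
       smooth_fun M (U \<inter> V) (\<lambda>p. \<Psi> p (frame E \<Phi> j p) i))"

text \<open>Smooth sections, extended by \<open>0\<close> off \<open>M\<close> so that equality of sections is equality of
  functions.\<close>

definition sections :: "'a manifold \<Rightarrow> ('a, 'v::real_vector) vbundle \<Rightarrow> ('a \<Rightarrow> 'v) set"
  where "sections M E = {X.
    (\<forall>p\<in>topspace (mtop M). X p \<in> fibre E p) \<and> (\<forall>p. p \<notin> topspace (mtop M) \<longrightarrow> X p = 0) \<and>
    (\<forall>(U, \<Phi>)\<in>trivs E. \<forall>i<rank E. smooth_fun M U (\<lambda>p. \<Phi> p (X p) i))}"

text \<open>Smooth vector bundle maps over the identity: fibrewise linear, with smooth matrix entries
  in all pairs of local trivialisations.\<close>

definition bundle_map ::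
  "'a manifold \<Rightarrow> ('a, 'v::real_vector) vbundle \<Rightarrow> ('a, 'w::real_vector) vbundle \<Rightarrow>
    ('a \<Rightarrow> 'v \<Rightarrow> 'w) \<Rightarrow> bool"
  where "bundle_map M E F q \<longleftrightarrow>
    (\<forall>p\<in>topspace (mtop M). linear_between (fibre E p) (fibre F p) (q p)) \<and>
    (\<forall>(U, \<Phi>)\<in>trivs E. \<forall>(V, \<Psi>)\<in>trivs F. \<forall>i<rank F. \<forall>j<rank E.
       smooth_fun M (U \<inter> V) (\<lambda>p. \<Psi> p (q p (frame E \<Phi> j p)) i))"

definition app_section ::
  "'a manifold \<Rightarrow> ('a \<Rightarrow> 'v \<Rightarrow> 'w::real_vector) \<Rightarrow> ('a \<Rightarrow> 'v) \<Rightarrow> 'a \<Rightarrow> 'w"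
  where "app_section M q X = (\<lambda>p. if p \<in> topspace (mtop M) then q p (X p) else 0)"

definition fun_scale :: "('a \<Rightarrow> real) \<Rightarrow> ('a \<Rightarrow> 'v::real_vector) \<Rightarrow> 'a \<Rightarrow> 'v"
  where "fun_scale f X = (\<lambda>p. f p *\<^sub>R X p)"


section \<open>The tangent bundle\<close>

type_synonym 'a tvec = "('a \<Rightarrow> real) \<Rightarrow> real"

text \<open>A tangent vector at \<open>p\<close> is a derivation of the algebra of germs at \<open>p\<close> of smooth functions,
  represented as a functional on all functions that is \<open>0\<close> on those not smooth near \<open>p\<close>.\<close>

definition tangent_space :: "'a manifold \<Rightarrow> 'a \<Rightarrow> 'a tvec set"
  where "tangent_space M p = {v.
    (\<forall>f. \<not> smooth_near M p f \<longrightarrow> v f = 0) \<and>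
    (\<forall>f g W. smooth_near M p f \<and> smooth_near M p g \<and>
       openin (mtop M) W \<and> p \<in> W \<and> (\<forall>x\<in>W. f x = g x) \<longrightarrow> v f = v g) \<and>
    (\<forall>c f. smooth_near M p f \<longrightarrow> v (\<lambda>x. c * f x) = c * v f) \<and>
    (\<forall>f g. smooth_near M p f \<and> smooth_near M p g \<longrightarrow>
       v (\<lambda>x. f x + g x) = v f + v g \<and>
       v (\<lambda>x. f x * g x) = f p * v g + g p * v f)}"

text \<open>A chart \<open>(U, \<phi>)\<close> trivialises the tangent bundle over \<open>U\<close> by sending \<open>v\<close> to its components
  $v(x^i)$, where $x^i$ is the coordinate function \<open>\<lambda>x. \<phi> x i\<close>.\<close>

definition tangent_bundle :: "'a manifold \<Rightarrow> ('a, 'a tvec) vbundle"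
  where "tangent_bundle M = \<lparr>
    fibre = tangent_space M,
    rank = mdim M,
    trivs = (\<lambda>(U, \<phi>). (U, \<lambda>p v i. v (\<lambda>x. \<phi> x i))) ` charts M\<rparr>"

abbreviation vector_fields :: "'a manifold \<Rightarrow> ('a \<Rightarrow> 'a tvec) set"
  where "vector_fields M \<equiv> sections M (tangent_bundle M)"

definition vf_apply :: "('a \<Rightarrow> 'a tvec) \<Rightarrow> ('a \<Rightarrow> real) \<Rightarrow> 'a \<Rightarrow> real"
  where "vf_apply X f = (\<lambda>p. X p f)"

text \<open>The guard keeps the value a tangent vector in the above representation:
  \<open>vf_apply Y f\<close> may be smooth near \<open>p\<close> although \<open>f\<close> is not.\<close>

definition vf_bracket ::
  "'a manifold \<Rightarrow> ('a \<Rightarrow> 'a tvec) \<Rightarrow> ('a \<Rightarrow> 'a tvec) \<Rightarrow> 'a \<Rightarrow> 'a tvec"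
  where "vf_bracket M X Y = (\<lambda>p f.
    if smooth_near M p f then X p (vf_apply Y f) - Y p (vf_apply X f) else 0)"


section \<open>Lie algebroids\<close>

definition lie_bracket_on :: "'v::real_vector set \<Rightarrow> ('v \<Rightarrow> 'v \<Rightarrow> 'v) \<Rightarrow> bool"
  where "lie_bracket_on V br \<longleftrightarrow>
    (\<forall>x\<in>V. \<forall>y\<in>V. br x y \<in> V) \<and>
    (\<forall>x\<in>V. \<forall>y\<in>V. \<forall>z\<in>V. br (x + y) z = br x z + br y z \<and> br z (x + y) = br z x + br z y) \<and>
    (\<forall>c. \<forall>x\<in>V. \<forall>y\<in>V. br (c *\<^sub>R x) y = c *\<^sub>R br x y \<and> br x (c *\<^sub>R y) = c *\<^sub>R br x y) \<and>
    (\<forall>x\<in>V. br x x = 0) \<and>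
    (\<forall>x\<in>V. \<forall>y\<in>V. \<forall>z\<in>V. br x (br y z) + br y (br z x) + br z (br x y) = 0)"

definition lie_algebroid ::
  "'a manifold \<Rightarrow> ('a, 'v::real_vector) vbundle \<Rightarrow> ('a \<Rightarrow> 'v \<Rightarrow> 'a tvec) \<Rightarrow>
    (('a \<Rightarrow> 'v) \<Rightarrow> ('a \<Rightarrow> 'v) \<Rightarrow> 'a \<Rightarrow> 'v) \<Rightarrow> bool"
  where "lie_algebroid M E q br \<longleftrightarrow>
    vector_bundle M E \<and> bundle_map M E (tangent_bundle M) q \<and>
    lie_bracket_on (sections M E) br \<and>
    (\<forall>A\<in>sections M E. \<forall>B\<in>sections M E. \<forall>f. smooth_fun M (topspace (mtop M)) f \<longrightarrow>
       br A (fun_scale f B) =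
         fun_scale f (br A B) + fun_scale (vf_apply (app_section M q A) f) B)"


section \<open>Endomorphisms of the tangent bundle\<close>

definition contracted_bracket ::
  "'a manifold \<Rightarrow> ('a \<Rightarrow> 'a tvec \<Rightarrow> 'a tvec) \<Rightarrow>
    ('a \<Rightarrow> 'a tvec) \<Rightarrow> ('a \<Rightarrow> 'a tvec) \<Rightarrow> 'a \<Rightarrow> 'a tvec"
  where "contracted_bracket M N X Y =
    vf_bracket M (app_section M N X) Y + vf_bracket M X (app_section M N Y)
    - app_section M N (vf_bracket M X Y)"

definition nijenhuis_torsion ::
  "'a manifold \<Rightarrow> ('a \<Rightarrow> 'a tvec \<Rightarrow> 'a tvec) \<Rightarrow>
    ('a \<Rightarrow> 'a tvec) \<Rightarrow> ('a \<Rightarrow> 'a tvec) \<Rightarrow> 'a \<Rightarrow> 'a tvec"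
  where "nijenhuis_torsion M N X Y =
    vf_bracket M (app_section M N X) (app_section M N Y)
    - app_section M N (vf_bracket M (app_section M N X) Y)
    - app_section M N (vf_bracket M X (app_section M N Y))
    + app_section M N (app_section M N (vf_bracket M X Y))"

definition involutive_image :: "'a manifold \<Rightarrow> ('a \<Rightarrow> 'a tvec \<Rightarrow> 'a tvec) \<Rightarrow> bool"
  where "involutive_image M N \<longleftrightarrow>
    (\<forall>X\<in>vector_fields M. \<forall>Y\<in>vector_fields M. \<forall>p\<in>topspace (mtop M).
       vf_bracket M (app_section M N X) (app_section M N Y) p \<in> N p ` tangent_space M p)"

end

theory Submission
  imports Defs
begin

text \<open>Write \<open>P\<close> for the action of \<open>N\<close> on vector fields and \<open>Q = 1 - P\<close>. Since \<open>P\<close> is idempotent and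
  its image is a Lie subalgebra, the bracket equals
  \<open>[PX, PY] + Q ([PX, QY] + [QX, PY])\<close>: the semidirect product of \<open>Im P\<close> with \<open>Ker P\<close>, on which
  \<open>Im P\<close> acts by the (flat) Bott connection and whose own bracket is set to zero. The Jacobi identity
  is therefore purely algebraic once vector fields are known to be closed under the Lie bracket and
  under \<open>P\<close>. That closure, and the fact that the coordinate functions trivialise the space of
  derivations, rest on the Hadamard lemma \<open>f y = f x + (\<Sum>j. (y j - x j) * h j y)\<close> with smooth
  \<open>h j\<close>.\<close>

section \<open>Functions of class $C^k$ on Euclidean space\<close>

text \<open>Smoothness is defined by iterated partial derivatives along coordinate lines, so the
  chain rule has to be earned. The Hadamard coefficients supply the continuous slopes for it, and
  the chain rule in turn makes smoothness testable in a single chart. The coefficients must moreover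
  be smooth themselves: the Leibniz rule of a derivation applies only to smooth factors, and it is
  what reduces a derivation to its values on coordinates. Since \<open>h j\<close> is an integral
  with parameters, this calls for differentiation under the integral sign to every order. Tangent
  vectors see germs, so an identity such as \<open>[X, Y] f = X (Y f) - Y (X f)\<close> has to hold
  on a neighbourhood before another vector field may be applied to it. On the algebraic side, the
  \<open>P\<close>-part of the Jacobi sum is the Jacobi identity inside \<open>Im P\<close>; the
  \<open>Q\<close>-part is \<open>Q\<close> of three Jacobi sums, each with exactly one argument in
  \<open>Ker P\<close>. Involutivity enters twice: \<open>Im P\<close> is closed, and
  \<open>[PX, Y]\<close> modulo \<open>Im P\<close> depends only on \<open>Y\<close> modulo
  \<open>Im P\<close>.\<close>

text \<open>Product form lets membership be checked one coordinate at a time, which suits both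
  \<open>x(i := t)\<close> and the coordinatewise paths of the Hadamard expansion. Coordinates from
  \<open>n\<close> on are pinned to 0 because the points live in
  \<open>nat \<Rightarrow> real\<close>.\<close>

definition cube :: "nat \<Rightarrow> (nat \<Rightarrow> real) \<Rightarrow> real \<Rightarrow> (nat \<Rightarrow> real) set"
  where "cube n x e = {y. (\<forall>i<n. \<bar>y i - x i\<bar> < e) \<and> (\<forall>i\<ge>n. y i = 0)}"

lemma openin_cube: "openin (Euclidean_space n) (cube n x e)"
proof -
  have "open (\<Inter>i\<in>{..<n}. {y::nat \<Rightarrow> real. \<bar>y i - x i\<bar> < e})"
    by (intro open_INT ballI finite_lessThan open_Collect_less continuous_intros
        continuous_on_subset[OF continuous_on_product_coordinates]) auto
  moreover have "cube n x e = (\<Inter>i\<in>{..<n}. {y. \<bar>y i - x i\<bar> < e}) \<inter> {y. \<forall>i\<ge>n. y i = 0}"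
    by (auto simp: cube_def)
  ultimately show ?thesis
    unfolding Euclidean_space_def euclidean_product_topology openin_subtopology by auto
qed

lemma openin_Euclidean_imp_cube:
  assumes "openin (Euclidean_space n) S" "x \<in> S"
  obtains e where "e > 0" "cube n x e \<subseteq> S"
proof -
  obtain T where T: "openin (powertop_real UNIV) T" "S = T \<inter> {x. \<forall>i\<ge>n. x i = 0}"
    using assms(1) unfolding Euclidean_space_def openin_subtopology by auto
  have "x \<in> T" and x0: "\<forall>i\<ge>n. x i = 0" using assms(2) T by auto
  then obtain U where U: "\<forall>i. open (U i)" "x \<in> Pi\<^sub>E UNIV U" "Pi\<^sub>E UNIV U \<subseteq> T"
    using T(1) unfolding openin_product_topology_alt by fastforce
  have "\<forall>i. \<exists>d>0. ball (x i) d \<subseteq> U i"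
    using U(1,2) by (metis PiE_mem UNIV_I open_contains_ball)
  then obtain d where d: "\<And>i. d i > 0" "\<And>i. ball (x i) (d i) \<subseteq> U i" by metis
  \<comment> \<open>The 1 keeps the minimum defined when \<open>n = 0\<close>.\<close>
  define e where "e = Min (insert 1 (d ` {..<n}))"
  have "e > 0" using d(1) by (simp add: e_def)
  moreover have "cube n x e \<subseteq> S"
  proof
    fix y assume y: "y \<in> cube n x e"
    have "y i \<in> U i" for i
    proof (cases "i < n")
      case True
      then have "e \<le> d i" by (simp add: e_def)
      then have "y i \<in> ball (x i) (d i)"
        using y True by (auto simp: cube_def dist_real_def abs_minus_commute intro: less_le_trans)
      then show ?thesis using d(2) by blast
    next
      case False
      then have "y i = x i" using y x0 by (simp add: cube_def)
      then show ?thesis using U(2) by auto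
    qed
    then have "y \<in> T" using U(3) by auto
    then show "y \<in> S" using y T(2) by (auto simp: cube_def)
  qed
  ultimately show ?thesis using that by blast
qed

lemma openin_EuclideanD: "openin (Euclidean_space n) S \<Longrightarrow> x \<in> S \<Longrightarrow> i \<ge> n \<Longrightarrow> x i = 0"
  using openin_subset[of "Euclidean_space n" S] by (auto simp: topspace_Euclidean_space)

text \<open>Makes \<open>partial i f x\<close> depend only on the values of \<open>f\<close> on
  \<open>S\<close>. The bound \<open>i < n\<close> matters: changing a later coordinate leaves the
  space.\<close>

lemma eventually_fun_upd_in:
  assumes "openin (Euclidean_space n) S" "x \<in> S" "i < n"
  shows "\<forall>\<^sub>F t in nhds (x i). x(i := t) \<in> S"
proof -
  obtain e where e: "e > 0" "cube n x e \<subseteq> S"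
    using openin_Euclidean_imp_cube assms by metis
  have "x(i := t) \<in> S" if "dist t (x i) < e" for t
    using that e(1) assms(3) openin_EuclideanD[OF assms(1,2)]
    by (intro subsetD[OF e(2)]) (auto simp: cube_def dist_real_def)
  then show ?thesis using e(1) unfolding eventually_nhds_metric by blast
qed

lemma tendsto_coordinatewise:
  fixes l :: "'i \<Rightarrow> 'b::topological_space"
  assumes "\<And>i. ((\<lambda>c. f c i) \<longlongrightarrow> l i) F"
  shows "(f \<longlongrightarrow> l) F"
  using assms limitin_componentwise[of "\<lambda>_. euclidean" UNIV f l F]
  by (simp add: euclidean_product_topology)

lemma Ck_imp_continuous_on: "Ck n k S f \<Longrightarrow> continuous_on S f"
  by (cases k) auto

lemma Ck_has_partial:
  assumes "Ck n (Suc k) S f" "x \<in> S" "i < n"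
  shows "((\<lambda>t. f (x(i := t))) has_field_derivative partial i f x) (at (x i))"
  using assms unfolding partial_def by (simp add: DERIV_deriv_iff_real_differentiable)

lemma partialI:
  "((\<lambda>t. f (x(i := t))) has_field_derivative d) (at (x i)) \<Longrightarrow> partial i f x = d"
  unfolding partial_def by (rule DERIV_imp_deriv)

lemma partial_cong:
  assumes "openin (Euclidean_space n) S" "x \<in> S" "i < n" "\<And>x. x \<in> S \<Longrightarrow> f x = g x"
  shows "partial i f x = partial i g x"
  unfolding partial_def using eventually_fun_upd_in[OF assms(1-3)] assms(4)
  by (intro deriv_cong_ev) (auto elim: eventually_mono)

lemma Ck_cong:
  assumes S: "openin (Euclidean_space n) S"
  shows "(\<And>x. x \<in> S \<Longrightarrow> f x = g x) \<Longrightarrow> Ck n k S f \<longleftrightarrow> Ck n k S g"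
proof (induction k arbitrary: f g)
  case 0
  then show ?case by (simp cong: continuous_on_cong)
next
  case (Suc k)
  have "continuous_on S f \<longleftrightarrow> continuous_on S g"
    using Suc.prems by (simp cong: continuous_on_cong)
  moreover have "Ck n k S (partial i f) \<longleftrightarrow> Ck n k S (partial i g)" if "i < n" for i
    using partial_cong[OF S _ that Suc.prems] by (intro Suc.IH)
  moreover have "(\<lambda>t. f (x(i := t))) differentiable (at (x i)) \<longleftrightarrow>
      (\<lambda>t. g (x(i := t))) differentiable (at (x i))" if "x \<in> S" "i < n" for x i
  proof -
    have "\<forall>\<^sub>F t in nhds (x i). f (x(i := t)) = g (x(i := t))"
      using eventually_fun_upd_in[OF S that] by eventually_elim (rule Suc.prems)
    from DERIV_cong_ev[OF refl this refl] show ?thesis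
      unfolding real_differentiable_def by blast
  qed
  ultimately show ?case by (auto 0 0)
qed

text \<open>Replaces \<open>partial i f\<close>, defined through \<open>deriv\<close>, by any
  explicit formula \<open>g i\<close> for the derivative. The closure properties below exhibit such
  a formula and induct on \<open>k\<close>.\<close>

lemma Ck_SucI:
  assumes "openin (Euclidean_space n) S" "continuous_on S f"
    and d: "\<And>x i. x \<in> S \<Longrightarrow> i < n \<Longrightarrow> ((\<lambda>t. f (x(i := t))) has_field_derivative g i x) (at (x i))"
    and g: "\<And>i. i < n \<Longrightarrow> Ck n k S (g i)"
  shows "Ck n (Suc k) S f"
proof -
  have "Ck n k S (partial i f)" if "i < n" for i
  proof -
    have "partial i f x = g i x" if "x \<in> S" for x by (rule partialI[OF d[OF that \<open>i < n\<close>]])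
    then show ?thesis using Ck_cong[OF assms(1)] g[OF that] by blast
  qed
  then show ?thesis using assms(2) d by (auto simp: real_differentiable_def)
qed

lemma Ck_subset: "Ck n k S f \<Longrightarrow> T \<subseteq> S \<Longrightarrow> Ck n k T f"
  by (induction k arbitrary: f) (auto intro: continuous_on_subset)

lemma Ck_Suc_imp: "Ck n (Suc k) S f \<Longrightarrow> Ck n k S f"
  by (induction k arbitrary: f) auto

lemma Ck_le: "Ck n k S f \<Longrightarrow> m \<le> k \<Longrightarrow> Ck n m S f"
  by (induction k) (auto simp del: Ck.simps simp: le_Suc_eq dest: Ck_Suc_imp)

text \<open>Existence of partial derivatives is a pointwise condition, so only continuity has to be
  glued. The local hypothesis, with neighbourhoods shrunk into \<open>S\<close>, passes from
  \<open>f\<close> to every \<open>partial i f\<close>, and this drives the induction.\<close>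

lemma Ck_local:
  assumes S: "openin (Euclidean_space n) S"
    and loc: "\<And>x. x \<in> S \<Longrightarrow> \<exists>W. openin (Euclidean_space n) W \<and> x \<in> W \<and> Ck n k (W \<inter> S) f"
  shows "Ck n k S f"
proof -
  have *: "\<forall>x\<in>S. \<exists>W. openin (Euclidean_space n) W \<and> x \<in> W \<and> W \<subseteq> S \<and> Ck n k W f"
  proof
    fix x assume "x \<in> S"
    with loc obtain W where "openin (Euclidean_space n) W" "x \<in> W" "Ck n k (W \<inter> S) f" by blast
    then show "\<exists>W. openin (Euclidean_space n) W \<and> x \<in> W \<and> W \<subseteq> S \<and> Ck n k W f"
      using \<open>x \<in> S\<close> S by (intro exI[of _ "W \<inter> S"]) auto
  qed
  have cont: "continuous_on S f"
    if c: "\<forall>x\<in>S. \<exists>W. openin (Euclidean_space n) W \<and> x \<in> W \<and> W \<subseteq> S \<and> continuous_on W f" for f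
  proof -
    have "\<forall>x\<in>S. \<exists>T. open T \<and> x \<in> T \<and> continuous_on (S \<inter> T) f"
    proof
      fix x assume "x \<in> S"
      with c obtain W where W: "openin (Euclidean_space n) W" "x \<in> W" "W \<subseteq> S" "continuous_on W f"
        by blast
      then obtain T where T: "open T" "W = T \<inter> {x. \<forall>i\<ge>n. x i = 0}"
        unfolding Euclidean_space_def openin_subtopology by (auto simp: euclidean_product_topology)
      have "S \<inter> T = W" using W(3) T(2) openin_EuclideanD[OF S] by auto
      then show "\<exists>T. open T \<and> x \<in> T \<and> continuous_on (S \<inter> T) f" using W T by auto
    qed
    then have "\<forall>x\<in>S. continuous (at x within S) f"
    proof safe
      fix x assume "x \<in> S" "\<forall>x\<in>S. \<exists>T. open T \<and> x \<in> T \<and> continuous_on (S \<inter> T) f"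
      then obtain T where T: "open T" "x \<in> T" "continuous_on (S \<inter> T) f" by blast
      have "at x within S = at x within (S \<inter> T)" by (rule at_within_nhd[OF T(2,1)]) auto
      then show "continuous (at x within S) f"
        using T \<open>x \<in> S\<close> by (simp add: continuous_on_eq_continuous_within)
    qed
    then show ?thesis by (simp add: continuous_on_eq_continuous_within)
  qed
  from * show ?thesis
  proof (induction k arbitrary: f)
    case 0
    then show ?case using cont by simp
  next
    case (Suc k)
    have "continuous_on S f" using Suc.prems by (intro cont) (meson Ck_imp_continuous_on)
    moreover have "Ck n k S (partial i f)" if "i < n" for i
      using Suc.prems that by (intro Suc.IH) fastforce
    ultimately show ?case using Suc.prems by fastforce
  qed
qed

section \<open>Closure of C^k under the algebra operations\<close>

lemma Ck_const: "openin (Euclidean_space n) S \<Longrightarrow> Ck n k S (\<lambda>x. c)"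
proof (induction k arbitrary: c)
  case (Suc k)
  then show ?case by (intro Ck_SucI[where g="\<lambda>i x. 0"]) (auto intro: derivative_eq_intros)
qed simp

lemma Ck_coordinate:
  assumes "openin (Euclidean_space n) S"
  shows "Ck n k S (\<lambda>x. x j)"
proof (cases k)
  case 0
  then show ?thesis by (auto intro: continuous_on_subset[OF continuous_on_product_coordinates])
next
  case (Suc m)
  show ?thesis unfolding Suc
    by (rule Ck_SucI[where g="\<lambda>i x. if i = j then 1 else 0"])
      (auto intro!: assms Ck_const derivative_eq_intros
        continuous_on_subset[OF continuous_on_product_coordinates])
qed

lemma Ck_add:
  assumes S: "openin (Euclidean_space n) S"
  shows "Ck n k S f \<Longrightarrow> Ck n k S g \<Longrightarrow> Ck n k S (\<lambda>x. f x + g x)"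
proof (induction k arbitrary: f g)
  case 0
  then show ?case by (auto intro: continuous_intros)
next
  case (Suc k)
  show ?case
  proof (rule Ck_SucI[OF S, where g="\<lambda>i x. partial i f x + partial i g x"])
    show "continuous_on S (\<lambda>x. f x + g x)"
      using Suc.prems by (auto intro: continuous_intros)
    show "((\<lambda>t. f (x(i := t)) + g (x(i := t))) has_field_derivative partial i f x + partial i g x) (at (x i))"
      if "x \<in> S" "i < n" for x i
      by (intro DERIV_add Ck_has_partial[OF Suc.prems(1) that] Ck_has_partial[OF Suc.prems(2) that])
    show "Ck n k S (\<lambda>x. partial i f x + partial i g x)" if "i < n" for i
      using Suc.prems that by (intro Suc.IH) auto
  qed
qed

lemma Ck_mult:
  assumes S: "openin (Euclidean_space n) S"
  shows "Ck n k S f \<Longrightarrow> Ck n k S g \<Longrightarrow> Ck n k S (\<lambda>x. f x * g x)"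
proof (induction k arbitrary: f g)
  case 0
  then show ?case by (auto intro: continuous_intros)
next
  case (Suc k)
  show ?case
  proof (rule Ck_SucI[OF S, where g="\<lambda>i x. partial i f x * g x + partial i g x * f x"])
    show "continuous_on S (\<lambda>x. f x * g x)"
      using Suc.prems by (auto intro: continuous_intros)
    show "((\<lambda>t. f (x(i := t)) * g (x(i := t))) has_field_derivative
        partial i f x * g x + partial i g x * f x) (at (x i))"
      if "x \<in> S" "i < n" for x i
      using DERIV_mult[OF Ck_has_partial[OF Suc.prems(1) that] Ck_has_partial[OF Suc.prems(2) that]]
      unfolding fun_upd_triv .
    show "Ck n k S (\<lambda>x. partial i f x * g x + partial i g x * f x)" if "i < n" for i
      using Suc.prems that Ck_Suc_imp[OF Suc.prems(1)] Ck_Suc_imp[OF Suc.prems(2)]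
      by (intro Ck_add[OF S] Suc.IH) auto
  qed
qed

lemma Ck_sum:
  assumes "openin (Euclidean_space n) S" "\<And>j. j \<in> J \<Longrightarrow> Ck n k S (f j)"
  shows "Ck n k S (\<lambda>x. \<Sum>j\<in>J. f j x)"
  using assms(2)
  by (induction J rule: infinite_finite_induct) (auto intro: Ck_const Ck_add assms(1))

text \<open>The Hadamard expansion moves from \<open>y\<close> to \<open>x\<close> one coordinate at a time: coordinates below \<open>j\<close>
  are already at \<open>x\<close>, those above \<open>j\<close> still at \<open>y\<close>. The weight \<open>s ^ m\<close> in the integrals below makes
  their class closed under partial derivatives.\<close>

definition tele :: "(nat \<Rightarrow> real) \<Rightarrow> nat \<Rightarrow> real \<Rightarrow> (nat \<Rightarrow> real) \<Rightarrow> nat \<Rightarrow> real"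
  where "tele x j s y = (\<lambda>i. if i < j then x i else if i = j then x i + s * (y i - x i) else y i)"

lemma tele_in_cube:
  assumes "x \<in> cube n x e" "y \<in> cube n x e" "0 \<le> s" "s \<le> 1"
  shows "tele x j s y \<in> cube n x e"
proof -
  have "\<bar>s * (y i - x i)\<bar> \<le> \<bar>y i - x i\<bar>" for i
    using assms(3,4) by (simp add: abs_mult mult_left_le_one_le)
  then show ?thesis
    using assms(1,2) unfolding cube_def tele_def
    by (auto intro: le_less_trans)
qed

lemma continuous_on_tele: "continuous_on UNIV (\<lambda>(y, s). tele x j s y)"
proof (rule continuous_on_coordinatewise_then_product)
  fix i
  have "continuous_on UNIV (\<lambda>p::(nat \<Rightarrow> real) \<times> real. fst p i)"
    by (rule continuous_on_compose2[OF continuous_on_product_coordinates]) (auto intro: continuous_intros)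
  then have "continuous_on UNIV (\<lambda>p::(nat \<Rightarrow> real) \<times> real. x i + snd p * (fst p i - x i))"
    by (intro continuous_intros)
  with \<open>continuous_on UNIV (\<lambda>p. fst p i)\<close>
  show "continuous_on UNIV (\<lambda>p. (case p of (y, s) \<Rightarrow> tele x j s y) i)"
    by (cases "i < j"; cases "i = j") (simp_all add: tele_def split_def)
qed

lemma continuous_on_tele_integrand:
  assumes "x \<in> cube n x e" "continuous_on (cube n x e) g"
  shows "continuous_on (cube n x e \<times> cbox 0 (1::real)) (\<lambda>(y, s). s ^ m * g (tele x j s y))"
proof -
  have "continuous_on (cube n x e \<times> cbox 0 (1::real)) (\<lambda>p. g (tele x j (snd p) (fst p)))"
    by (rule continuous_on_compose2[OF assms(2)])
      (use continuous_on_tele[of x j] tele_in_cube[OF assms(1)] in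
        \<open>auto simp: split_def intro: continuous_on_subset\<close>)
  then show ?thesis unfolding split_def by (intro continuous_intros)
qed

lemma continuous_on_fun_upd: "continuous_on UNIV (\<lambda>p. (x(i := fst p), snd p))"
  for x :: "nat \<Rightarrow> real"
proof (intro continuous_on_Pair continuous_on_coordinatewise_then_product)
  fix j show "continuous_on UNIV (\<lambda>p. (x(i := fst p)) j)"
    by (cases "j = i") (auto intro: continuous_intros)
qed (intro continuous_intros)

text \<open>Differentiation under the integral sign. As a function of \<open>y i\<close>, the point
  \<open>tele x j s y\<close> is constant for \<open>i < j\<close>, moves with slope
  \<open>s\<close> for \<open>i = j\<close> and with slope 1 for \<open>i > j\<close>; this gives
  the value 0 and the exponents \<open>Suc m\<close> and \<open>m\<close> in
  \<open>G\<close>.\<close>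

lemma Ck_tele_integral:
  assumes "x \<in> cube n x e"
  shows "Ck n k (cube n x e) g \<Longrightarrow>
    Ck n k (cube n x e) (\<lambda>y. integral (cbox 0 1) (\<lambda>s. s ^ m * g (tele x j s y)))"
proof (induction k arbitrary: g m)
  case 0
  then show ?case
    using integral_continuous_on_param[OF continuous_on_tele_integrand[OF assms]] by simp
next
  case (Suc k)
  let ?C = "cube n x e"
  define G where "G i y = (if i < j then 0 else
    integral (cbox 0 1) (\<lambda>s. s ^ (if i = j then Suc m else m) * partial i g (tele x j s y)))"
    for i and y :: "nat \<Rightarrow> real"
  have "continuous_on ?C (\<lambda>y. integral (cbox 0 1) (\<lambda>s. s ^ m * g (tele x j s y)))"
    using integral_continuous_on_param[OF continuous_on_tele_integrand[OF assms]]
      Ck_imp_continuous_on[OF Suc.prems] by blast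
  moreover have "((\<lambda>t. integral (cbox 0 1) (\<lambda>s. s ^ m * g (tele x j s (y(i := t)))))
      has_field_derivative G i y) (at (y i))" if y: "y \<in> ?C" and i: "i < n" for y i
  proof (cases "i < j")
    case True
    then have "tele x j s (y(i := t)) = tele x j s y" for s t
      by (auto simp: tele_def)
    then show ?thesis using True by (simp add: G_def)
  next
    case False
    \<comment> \<open>The open interval in which coordinate \<open>i\<close> may vary without
      leaving the cube; its convexity is required by the Leibniz rule for integrals.\<close>
    define U where "U = {t. \<bar>t - x i\<bar> < e}"
    have U: "open U" "convex U" "y i \<in> U"
    proof -
      have "U = ball (x i) e" by (auto simp: U_def dist_real_def abs_minus_commute)
      then show "open U" "convex U" by auto
      show "y i \<in> U" using y i by (simp add: U_def cube_def)
    qed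
    have yt: "y(i := t) \<in> ?C" if "t \<in> U" for t
      using y i that by (simp add: U_def cube_def)
    let ?m = "if i = j then Suc m else m"
    let ?fx = "\<lambda>t s. s ^ ?m * partial i g (tele x j s (y(i := t)))"
    have "((\<lambda>t. integral (cbox 0 1) (\<lambda>s. s ^ m * g (tele x j s (y(i := t)))))
      has_field_derivative integral (cbox 0 1) (?fx (y i))) (at (y i) within U)"
    proof (rule leibniz_rule_field_derivative)
      fix t s :: real assume t: "t \<in> U" and s: "s \<in> cbox 0 1"
      define z where "z = tele x j s (y(i := t))"
      have z: "z \<in> ?C" unfolding z_def using s by (intro tele_in_cube assms yt t) auto
      have d: "((\<lambda>u. g (z(i := u))) has_field_derivative partial i g z) (at (z i))"
        by (rule Ck_has_partial[OF Suc.prems z i])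
      \<comment> \<open>Coordinate \<open>i\<close> of the intermediate point as a function of the
        new value \<open>t\<close>. Since \<open>i < j\<close> is excluded, \<open>t\<close> enters
        through this coordinate alone, so a one-variable chain rule suffices.\<close>
      define a where "a = (\<lambda>t::real. if i = j then x i + s * (t - x i) else t)"
      have a: "(a has_field_derivative (if i = j then s else 1)) (at t)"
        unfolding a_def by (auto intro!: derivative_eq_intros)
      have at: "a t = z i" using False by (simp add: a_def tele_def z_def)
      have eq: "tele x j s (y(i := u)) = z(i := a u)" for u
        using False by (auto simp: tele_def a_def z_def)
      from DERIV_chain2[OF d[folded at] a]
      have "((\<lambda>u. g (tele x j s (y(i := u)))) has_field_derivative
          partial i g z * (if i = j then s else 1)) (at t)"
        by (simp add: eq)
      from DERIV_cmult[OF this, of "s ^ m"]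
      show "((\<lambda>t. s ^ m * g (tele x j s (y(i := t)))) has_field_derivative ?fx t s) (at t within U)"
        unfolding z_def[symmetric]
        by (auto intro: has_field_derivative_at_within simp: mult_ac z_def[symmetric] split: if_splits)
    next
      fix t assume t: "t \<in> U"
      have "continuous_on (cbox 0 1) (\<lambda>s. (\<lambda>(y, s). s ^ m * g (tele x j s y)) (y(i := t), s))"
        by (rule continuous_on_compose2[OF continuous_on_tele_integrand[OF assms
              Ck_imp_continuous_on[OF Suc.prems]]])
          (use yt[OF t] in \<open>auto intro!: continuous_on_Pair continuous_on_const continuous_on_id\<close>)
      then have "continuous_on (cbox 0 1) (\<lambda>s. s ^ m * g (tele x j s (y(i := t))))"
        unfolding prod.case .
      then show "(\<lambda>s. s ^ m * g (tele x j s (y(i := t)))) integrable_on cbox 0 1"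
        by (rule integrable_continuous)
    next
      have c: "continuous_on ?C (partial i g)"
        by (rule Ck_imp_continuous_on[of n k]) (use Suc.prems i in simp)
      have "continuous_on (U \<times> cbox 0 1) (\<lambda>p. (\<lambda>(y, s). s ^ ?m * partial i g (tele x j s y))
          (y(i := fst p), snd p))"
        by (rule continuous_on_compose2[OF continuous_on_tele_integrand[OF assms c]])
          (use yt continuous_on_fun_upd[of y i] in \<open>auto intro: continuous_on_subset\<close>)
      then show "continuous_on (U \<times> cbox 0 1) (\<lambda>(t, s). ?fx t s)"
        by (simp add: split_def)
    qed (use U in auto)
    then show ?thesis using False U by (simp add: G_def at_within_open[OF U(3,1)])
  qed
  moreover have "Ck n k ?C (G i)" if "i < n" for i
  proof (cases "i < j")
    case True
    then have "G i = (\<lambda>y. 0)" by (simp add: G_def fun_eq_iff)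
    then show ?thesis by (simp add: Ck_const openin_cube)
  next
    case False
    then have "G i = (\<lambda>y. integral (cbox 0 1)
        (\<lambda>s. s ^ (if i = j then Suc m else m) * partial i g (tele x j s y)))"
      by (simp add: G_def fun_eq_iff)
    moreover have "Ck n k ?C (partial i g)" using Suc.prems that by simp
    ultimately show ?thesis using Suc.IH by metis
  qed
  ultimately show ?case by (rule Ck_SucI[OF openin_cube])
qed

text \<open>The member \<open>m = 0\<close> of the family of integrals above, taken for
  \<open>partial j f\<close>; hence one order of differentiability is lost against
  \<open>f\<close>.\<close>

definition hadamard :: "(nat \<Rightarrow> real) \<Rightarrow> ((nat \<Rightarrow> real) \<Rightarrow> real) \<Rightarrow> nat \<Rightarrow> (nat \<Rightarrow> real) \<Rightarrow> real"
  where "hadamard x f j y = integral (cbox 0 1) (\<lambda>s. partial j f (tele x j s y))"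

lemma Ck_hadamard:
  "x \<in> cube n x e \<Longrightarrow> Ck n (Suc k) (cube n x e) f \<Longrightarrow> j < n \<Longrightarrow> Ck n k (cube n x e) (hadamard x f j)"
  using Ck_tele_integral[of x n e k "partial j f" 0 j] unfolding hadamard_def by simp

text \<open>Every intermediate point between \<open>x\<close> and itself is \<open>x\<close>, so the
  integrand is constant on an interval of length 1.\<close>

lemma hadamard_center: "hadamard x f j x = partial j f x"
proof -
  have "tele x j s x = x" for s by (auto simp: tele_def)
  then show ?thesis by (simp add: hadamard_def)
qed

lemma hadamard_expansion:
  assumes x: "x \<in> cube n x e" and f: "Ck n (Suc k) (cube n x e) f" and y: "y \<in> cube n x e"
  shows "f y = f x + (\<Sum>j<n. (y j - x j) * hadamard x f j y)"
proof -
  \<comment> \<open>Hybrid points with \<open>z 0 = y\<close> and, because coordinates from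
    \<open>n\<close> on vanish in the cube, \<open>z n = x\<close>. As \<open>s\<close> runs from 0
    to 1, \<open>tele x j s y\<close> runs from \<open>z (Suc j)\<close> to
    \<open>z j\<close>.\<close>
  define z where "z j = (\<lambda>i. if i < j then x i else y i)" for j
  have step: "f (z j) - f (z (Suc j)) = (y j - x j) * hadamard x f j y" if j: "j < n" for j
  proof -
    define h where "h s = f (tele x j s y)" for s
    have "((\<lambda>s. (y j - x j) * partial j f (tele x j s y)) has_integral h 1 - h 0) {0..1}"
    proof (rule fundamental_theorem_of_calculus)
      fix s :: real assume s: "s \<in> {0..1}"
      define z where "z = tele x j s y"
      have z: "z \<in> cube n x e" unfolding z_def using s by (intro tele_in_cube x y) auto
      have d: "((\<lambda>u. f (z(j := u))) has_field_derivative partial j f z) (at (z j))"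
        by (rule Ck_has_partial[OF f z j])
      define a where "a = (\<lambda>s. x j + s * (y j - x j))"
      have a: "(a has_field_derivative (y j - x j)) (at s)"
        unfolding a_def by (auto intro!: derivative_eq_intros)
      have at: "a s = z j" by (simp add: a_def tele_def z_def)
      have eq: "tele x j u y = z(j := a u)" for u by (auto simp: tele_def a_def z_def)
      have "h = (\<lambda>s. f (z(j := a s)))" by (simp add: fun_eq_iff h_def eq)
      with DERIV_chain2[OF d[folded at] a]
      have "(h has_field_derivative (y j - x j) * partial j f z) (at s)"
        by (simp add: mult.commute)
      then show "(h has_vector_derivative (y j - x j) * partial j f (tele x j s y)) (at s within {0..1})"
        by (simp add: z_def has_real_derivative_iff_has_vector_derivative[symmetric] has_field_derivative_at_within)
    qed simp
    moreover have "tele x j 1 y = z j" "tele x j 0 y = z (Suc j)"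
      by (auto simp: tele_def z_def)
    ultimately have "integral (cbox 0 1) (\<lambda>s. (y j - x j) * partial j f (tele x j s y)) = f (z j) - f (z (Suc j))"
      by (auto simp: h_def dest: integral_unique)
    then show ?thesis by (simp add: hadamard_def)
  qed
  have "(\<Sum>j<n. (y j - x j) * hadamard x f j y) = (\<Sum>j<n. f (z j) - f (z (Suc j)))"
    using step by simp
  also have "\<dots> = f (z 0) - f (z n)" by (rule sum_lessThan_telescope')
  also have "z n = x"
  proof
    fix i show "z n i = x i" using x y by (cases "i < n") (auto simp: z_def cube_def)
  qed
  finally show ?thesis by (simp add: z_def)
qed

text \<open>Caratheodory's criterion, with the continuous Hadamard coefficients as slopes.\<close>

lemma chain_rule:
  assumes S: "openin (Euclidean_space n) S" and f: "Ck n (Suc 0) S f"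
    and t: "\<gamma> t \<in> S" "\<forall>\<^sub>F u in nhds t. \<gamma> u \<in> S"
    and d: "\<And>j. j < n \<Longrightarrow> ((\<lambda>u. \<gamma> u j) has_field_derivative D j) (at t)"
  shows "((\<lambda>u. f (\<gamma> u)) has_field_derivative (\<Sum>j<n. partial j f (\<gamma> t) * D j)) (at t)"
proof -
  define x where "x = \<gamma> t"
  obtain e where e: "e > 0" "cube n x e \<subseteq> S"
    using openin_Euclidean_imp_cube[OF S t(1)] unfolding x_def by metis
  let ?C = "cube n x e"
  have x: "x \<in> ?C" using e(1) openin_EuclideanD[OF S t(1)] by (auto simp: cube_def x_def)
  have f': "Ck n (Suc 0) ?C f" using f e(2) by (rule Ck_subset)
  have lim: "((\<lambda>u. \<gamma> u j) \<longlongrightarrow> x j) (at t)" if "j < n" for j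
    using DERIV_isCont[OF d[OF that]] by (simp add: isCont_def x_def)
  have ev: "\<forall>\<^sub>F u in at t. \<gamma> u \<in> ?C"
  proof -
    have "\<forall>\<^sub>F u in at t. \<gamma> u \<in> S"
      using t(2) unfolding eventually_at_filter by (auto elim: eventually_mono)
    moreover have "\<forall>\<^sub>F u in at t. \<forall>j\<in>{..<n}. \<bar>\<gamma> u j - x j\<bar> < e"
      using tendstoD[OF lim e(1)] by (intro eventually_ball_finite) (auto simp: dist_real_def)
    ultimately show ?thesis
      by eventually_elim (use openin_EuclideanD[OF S] in \<open>auto simp: cube_def\<close>)
  qed
  have hlim: "((\<lambda>u. hadamard x f j (\<gamma> u)) \<longlongrightarrow> partial j f x) (at t)" if "j < n" for j
  proof -
    have "continuous_on ?C (hadamard x f j)"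
      using Ck_hadamard[OF x f' that] by simp
    moreover have "(\<gamma> \<longlongrightarrow> x) (at t)"
    proof (rule tendsto_coordinatewise)
      fix i show "((\<lambda>u. \<gamma> u i) \<longlongrightarrow> x i) (at t)"
      proof (cases "i < n")
        \<comment> \<open>Convergence in the product topology also concerns the coordinates from
          \<open>n\<close> on; there \<open>\<gamma> u\<close> and \<open>x\<close> both vanish once
          \<open>\<gamma> u\<close> lies in the cube.\<close>
        case False
        have "\<forall>\<^sub>F u in at t. x i = \<gamma> u i"
          using ev by eventually_elim (use False x in \<open>auto simp: cube_def\<close>)
        then show ?thesis by (rule Lim_transform_eventually[OF tendsto_const])
      qed (use lim in auto)
    qed
    ultimately have "((\<lambda>u. hadamard x f j (\<gamma> u)) \<longlongrightarrow> hadamard x f j x) (at t)"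
      using continuous_on_tendsto_compose[OF _ _ x ev] by blast
    then show ?thesis by (simp add: hadamard_center)
  qed
  have "((\<lambda>u. \<Sum>j<n. (\<gamma> u j - x j) / (u - t) * hadamard x f j (\<gamma> u)) \<longlongrightarrow>
      (\<Sum>j<n. D j * partial j f x)) (at t)"
    using d hlim by (intro tendsto_sum tendsto_mult) (auto simp: has_field_derivative_iff x_def)
  moreover have "\<forall>\<^sub>F u in at t. (\<Sum>j<n. (\<gamma> u j - x j) / (u - t) * hadamard x f j (\<gamma> u)) =
      (f (\<gamma> u) - f (\<gamma> t)) / (u - t)"
    using ev
  proof eventually_elim
    case (elim u)
    show ?case using hadamard_expansion[OF x f' elim]
      by (simp add: x_def[symmetric] sum_divide_distrib)
  qed
  ultimately show ?thesis
    unfolding has_field_derivative_iff x_def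
    by (auto intro: Lim_transform_eventually simp: mult.commute)
qed

lemma partial_compose:
  assumes S: "openin (Euclidean_space n) S" and T: "openin (Euclidean_space n) T"
    and f: "Ck n (Suc 0) T f" and g: "\<And>j. j < n \<Longrightarrow> Ck n (Suc 0) S (\<lambda>x. g x j)"
    and im: "g ` S \<subseteq> T" and x: "x \<in> S" "i < n"
  shows "((\<lambda>t. f (g (x(i := t)))) has_field_derivative
    (\<Sum>j<n. partial j f (g x) * partial i (\<lambda>x. g x j) x)) (at (x i))"
proof -
  have "\<forall>\<^sub>F t in nhds (x i). g (x(i := t)) \<in> T"
    using eventually_fun_upd_in[OF S x] by eventually_elim (use im in auto)
  from chain_rule[OF T f _ this Ck_has_partial[OF g x]] show ?thesis
    using im x by auto
qed

text \<open>By the chain rule a partial derivative of the composite is a sum of products of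
  \<open>partial j f\<close> composed with \<open>g\<close> and partial derivatives of
  \<open>g\<close>. The induction hypothesis covers the first factors, since \<open>f\<close> varies
  in it while \<open>g\<close> stays fixed.\<close>

lemma Ck_compose:
  assumes S: "openin (Euclidean_space n) S" and T: "openin (Euclidean_space n) T"
    and im: "g ` S \<subseteq> T"
  shows "Ck n k T f \<Longrightarrow> (\<And>j. j < n \<Longrightarrow> Ck n k S (\<lambda>x. g x j)) \<Longrightarrow> Ck n k S (\<lambda>x. f (g x))"
proof (induction k arbitrary: f)
  case 0
  have "continuous_on S (\<lambda>x. g x j)" for j
  proof (cases "j < n")
    case True
    then show ?thesis using 0 by simp
  next
    case False
    then have "g x j = 0" if "x \<in> S" for x using openin_EuclideanD[OF T] im that by auto
    then show ?thesis by (simp cong: continuous_on_cong)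
  qed
  then have "continuous_on S g" by (rule continuous_on_coordinatewise_then_product)
  then show ?case using 0 im by (auto intro: continuous_on_compose2[of T f S g])
next
  case (Suc k)
  have le: "Ck n (Suc 0) S h" if "Ck n (Suc k) S h" for S h
    by (rule Ck_le[OF that]) simp
  have IH: "Ck n k S (\<lambda>x. h (g x))" if "Ck n k T h" for h
    by (rule Suc.IH[OF that Ck_Suc_imp[OF Suc.prems(2)]])
  show ?case
  proof (rule Ck_SucI[OF S])
    show "continuous_on S (\<lambda>x. f (g x))"
      using IH[OF Ck_Suc_imp[OF Suc.prems(1)]] by (rule Ck_imp_continuous_on)
    show "((\<lambda>t. f (g (x(i := t)))) has_field_derivative
      (\<Sum>j<n. partial j f (g x) * partial i (\<lambda>x. g x j) x)) (at (x i))" if "x \<in> S" "i < n" for x i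
      by (rule partial_compose[OF S T le[OF Suc.prems(1)] le[OF Suc.prems(2)] im that])
    show "Ck n k S (\<lambda>x. \<Sum>j<n. partial j f (g x) * partial i (\<lambda>x. g x j) x)" if "i < n" for i
      using Suc.prems that by (intro Ck_sum Ck_mult IH S) auto
  qed
qed

section \<open>Smoothness of all orders\<close>

lemma Csmooth_cong:
  assumes "openin (Euclidean_space n) S" "\<And>x. x \<in> S \<Longrightarrow> f x = g x"
  shows "Csmooth n S f \<longleftrightarrow> Csmooth n S g"
  unfolding Csmooth_def by (intro all_cong1 Ck_cong[OF assms])

lemma Csmooth_subset: "Csmooth n S f \<Longrightarrow> T \<subseteq> S \<Longrightarrow> Csmooth n T f"
  unfolding Csmooth_def by (auto intro: Ck_subset)

lemma Csmooth_partial: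
  assumes "Csmooth n S f" "i < n"
  shows "Csmooth n S (partial i f)"
  unfolding Csmooth_def
proof
  fix k
  have "Ck n (Suc k) S f" using assms(1) unfolding Csmooth_def ..
  then show "Ck n k S (partial i f)" using assms(2) by simp
qed

lemma Csmooth_has_partial:
  assumes "Csmooth n S f" "x \<in> S" "i < n"
  shows "((\<lambda>t. f (x(i := t))) has_field_derivative partial i f x) (at (x i))"
  by (rule Ck_has_partial[of n 0 S]) (use assms in \<open>auto simp: Csmooth_def simp del: Ck.simps\<close>)

lemma Csmooth_local:
  assumes "openin (Euclidean_space n) S"
    and "\<And>x. x \<in> S \<Longrightarrow> \<exists>W. openin (Euclidean_space n) W \<and> x \<in> W \<and> Csmooth n W f"
  shows "Csmooth n S f"
  unfolding Csmooth_def
proof (intro allI Ck_local[OF assms(1)])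
  fix k x assume "x \<in> S"
  with assms(2) obtain W where W: "openin (Euclidean_space n) W" "x \<in> W" "Csmooth n W f" by blast
  then have "Ck n k (W \<inter> S) f" unfolding Csmooth_def using Ck_subset by blast
  with W show "\<exists>W. openin (Euclidean_space n) W \<and> x \<in> W \<and> Ck n k (W \<inter> S) f" by blast
qed


section \<open>The bracket of a split Lie algebra\<close>

lemma lie_bracket_onD:
  assumes "lie_bracket_on V b"
  shows "x \<in> V \<Longrightarrow> y \<in> V \<Longrightarrow> b x y \<in> V"
    and "x \<in> V \<Longrightarrow> y \<in> V \<Longrightarrow> z \<in> V \<Longrightarrow> b (x + y) z = b x z + b y z"
    and "x \<in> V \<Longrightarrow> y \<in> V \<Longrightarrow> z \<in> V \<Longrightarrow> b z (x + y) = b z x + b z y"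
    and "x \<in> V \<Longrightarrow> y \<in> V \<Longrightarrow> b (c *\<^sub>R x) y = c *\<^sub>R b x y"
    and "x \<in> V \<Longrightarrow> y \<in> V \<Longrightarrow> b x (c *\<^sub>R y) = c *\<^sub>R b x y"
    and "x \<in> V \<Longrightarrow> b x x = 0"
    and "x \<in> V \<Longrightarrow> y \<in> V \<Longrightarrow> z \<in> V \<Longrightarrow> b x (b y z) + b y (b z x) + b z (b x y) = 0"
  using assms unfolding lie_bracket_on_def by auto

lemma lie_bracket_on_minus:
  assumes "lie_bracket_on V b" "subspace V" "x \<in> V" "y \<in> V"
  shows "b x (- y) = - b x y"
  using lie_bracket_onD(5)[OF assms(1,3,4), of "- 1"] by simp

lemma lie_bracket_on_anticommute:
  assumes "lie_bracket_on V b" "subspace V" "x \<in> V" "y \<in> V"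
  shows "b y x = - b x y"
proof -
  have "x + y \<in> V" using assms(2-4) by (rule subspace_add)
  then have "0 = b (x + y) (x + y)" using lie_bracket_onD(6)[OF assms(1)] by simp
  also have "\<dots> = b x (x + y) + b y (x + y)"
    by (rule lie_bracket_onD(2)[OF assms(1,3,4) \<open>x + y \<in> V\<close>])
  also have "\<dots> = b x y + b y x"
    using assms(3,4) by (simp add: lie_bracket_onD(3,6)[OF assms(1)])
  finally show ?thesis by (simp add: eq_neg_iff_add_eq_0 add.commute)
qed

text \<open>To be instantiated with vector fields, their Lie bracket and the action of
  \<open>N\<close>. For an idempotent \<open>P\<close> the image is the set of fixed points, so
  \<open>invol\<close> says that \<open>Im P\<close> is a Lie subalgebra.\<close>

locale split_lie_algebra =
  fixes V :: "'v::real_vector set" and b :: "'v \<Rightarrow> 'v \<Rightarrow> 'v" and P :: "'v \<Rightarrow> 'v"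
  assumes lie: "lie_bracket_on V b" and V: "subspace V" and lin: "linear_between V V P"
    and idem: "x \<in> V \<Longrightarrow> P (P x) = P x"
    and invol: "x \<in> V \<Longrightarrow> y \<in> V \<Longrightarrow> P (b (P x) (P y)) = b (P x) (P y)"
begin

lemma P_in: "x \<in> V \<Longrightarrow> P x \<in> V"
  and P_add: "x \<in> V \<Longrightarrow> y \<in> V \<Longrightarrow> P (x + y) = P x + P y"
  and P_scale: "x \<in> V \<Longrightarrow> P (c *\<^sub>R x) = c *\<^sub>R P x"
  using lin unfolding linear_between_def by auto

lemma P_minus: "x \<in> V \<Longrightarrow> P (- x) = - P x"
  using P_scale[of x "- 1"] by simp

lemma P_diff: "x \<in> V \<Longrightarrow> y \<in> V \<Longrightarrow> P (x - y) = P x - P y"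
  using P_add[of x "- y"] P_minus[of y] subspace_neg[OF V, of y] by simp

lemmas b_in = lie_bracket_onD(1)[OF lie]
lemmas b_add = lie_bracket_onD(2,3)[OF lie]
lemmas b_scale = lie_bracket_onD(4,5)[OF lie]
lemmas V_closed = subspace_add[OF V] subspace_diff[OF V] subspace_scale[OF V] subspace_0[OF V] P_in b_in

lemma b_diff_right: "x \<in> V \<Longrightarrow> y \<in> V \<Longrightarrow> z \<in> V \<Longrightarrow> b z (x - y) = b z x - b z y"
  using b_add(2)[of x "- y" z] lie_bracket_on_minus[OF lie V, of z y] subspace_neg[OF V, of y] by simp

lemma b_diff_left: "x \<in> V \<Longrightarrow> y \<in> V \<Longrightarrow> z \<in> V \<Longrightarrow> b (x - y) z = b x z - b y z"
  using b_diff_right[of x y z] lie_bracket_on_anticommute[OF lie V, of z x]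
    lie_bracket_on_anticommute[OF lie V, of z y] lie_bracket_on_anticommute[OF lie V, of z "x - y"]
    subspace_diff[OF V, of x y] by simp

section \<open>The new bracket in terms of the projections \<open>P\<close> and
  \<open>Q\<close>\<close>

definition Q :: "'v \<Rightarrow> 'v" where "Q x = x - P x"

text \<open>The first parenthesis is the contracted bracket, the second the Nijenhuis torsion. The
  literal shape lets it be matched with the bracket of the theorem by mere unfolding.\<close>

definition br :: "'v \<Rightarrow> 'v \<Rightarrow> 'v"
  where "br x y = (b (P x) y + b x (P y) - P (b x y)) +
    (b (P x) (P y) - P (b (P x) y) - P (b x (P y)) + P (P (b x y)))"

lemma Q_in: "x \<in> V \<Longrightarrow> Q x \<in> V"
  by (simp add: Q_def V_closed)

lemma Q_add: "x \<in> V \<Longrightarrow> y \<in> V \<Longrightarrow> Q (x + y) = Q x + Q y"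
  by (simp add: Q_def P_add)

lemma Q_P: "x \<in> V \<Longrightarrow> Q (P x) = 0"
  by (simp add: Q_def idem)

lemma P_Q: "x \<in> V \<Longrightarrow> P (Q x) = 0"
  by (simp add: Q_def P_diff P_in idem)

lemma Q_Q: "x \<in> V \<Longrightarrow> Q (Q x) = Q x"
  unfolding Q_def[of "Q x"] by (simp add: P_Q)

lemma PQ_split: "x = P x + Q x"
  by (simp add: Q_def)

lemma Q_b_P: "x \<in> V \<Longrightarrow> y \<in> V \<Longrightarrow> Q (b (P x) (P y)) = 0"
  by (simp add: Q_def invol)

text \<open>Idempotence cancels \<open>- P (b x y)\<close> against \<open>P (P (b x y))\<close>, and
  the remaining terms with \<open>P\<close> in front combine with their counterparts to
  \<open>Q (b (P x) y + b x (P y))\<close>. Splitting the arguments then leaves only mixed terms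
  under \<open>Q\<close>.\<close>

lemma br_eq:
  assumes "x \<in> V" "y \<in> V"
  shows "br x y = b (P x) (P y) + Q (b (P x) (Q y) + b (Q x) (P y))"
proof -
  have "br x y = b (P x) (P y) + Q (b (P x) y + b x (P y))"
    using assms unfolding br_def Q_def by (simp add: idem P_add V_closed algebra_simps)
  \<comment> \<open>Splitting \<open>y\<close> in the first term and \<open>x\<close> in the second
    produces \<open>b (P x) (P y)\<close> twice; both copies lie in \<open>Im P\<close> and are
    killed by \<open>Q\<close>.\<close>
  also have "b (P x) y + b x (P y) =
      (b (P x) (P y) + b (P x) (P y)) + (b (P x) (Q y) + b (Q x) (P y))"
    using assms unfolding Q_def by (simp add: b_diff_left b_diff_right V_closed)
  also have "Q \<dots> = Q (b (P x) (Q y) + b (Q x) (P y))"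
    using assms by (simp add: Q_add Q_b_P V_closed Q_in)
  finally show ?thesis .
qed

lemma br_in: "x \<in> V \<Longrightarrow> y \<in> V \<Longrightarrow> br x y \<in> V"
  by (simp add: br_eq V_closed Q_in)

text \<open>The anchor is a homomorphism from \<open>br\<close> to \<open>b\<close>:
  \<open>P\<close> kills the \<open>Q\<close> term of \<open>br_eq\<close> and fixes the other by
  \<open>invol\<close>.\<close>

lemma P_br: "x \<in> V \<Longrightarrow> y \<in> V \<Longrightarrow> P (br x y) = b (P x) (P y)"
  by (simp add: br_eq P_add P_Q V_closed Q_in invol)

lemma Q_br: "x \<in> V \<Longrightarrow> y \<in> V \<Longrightarrow> Q (br x y) = Q (b (P x) (Q y) + b (Q x) (P y))"
  by (simp add: br_eq Q_add Q_Q V_closed Q_in Q_b_P)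

text \<open>Replacing \<open>y\<close> by \<open>Q y\<close> changes \<open>b (P x) y\<close> by an
  element of the subalgebra \<open>Im P\<close>, which \<open>Q\<close> kills. Thus
  \<open>Im P\<close> acts on \<open>V\<close> modulo \<open>Im P\<close>, identified with
  \<open>Ker P\<close>: this is the Bott connection.\<close>

lemma Q_b_Q: "x \<in> V \<Longrightarrow> y \<in> V \<Longrightarrow> Q (b (P x) (Q y)) = Q (b (P x) y)"
  using b_diff_right[of y "P y" "P x"] unfolding Q_def
  by (simp add: P_diff V_closed invol)

text \<open>The inner \<open>Q\<close> of \<open>Q (br y z)\<close> disappears by
  \<open>Q_b_Q\<close>, which leaves plain double brackets with exactly one argument from
  \<open>Ker P\<close> in each. This is what makes the Jacobi identity of \<open>b\<close>
  applicable.\<close>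

lemma Q_br_br:
  assumes "x \<in> V" "y \<in> V" "z \<in> V"
  shows "Q (br x (br y z)) =
    Q (b (P x) (b (P y) (Q z)) + b (P x) (b (Q y) (P z)) + b (Q x) (b (P y) (P z)))"
proof -
  have "Q (br x (br y z)) = Q (b (P x) (Q (br y z))) + Q (b (Q x) (b (P y) (P z)))"
    using assms by (simp add: Q_br P_br br_in Q_add V_closed Q_in)
  also have "Q (b (P x) (Q (br y z))) = Q (b (P x) (b (P y) (Q z) + b (Q y) (P z)))"
    using assms by (simp add: Q_br Q_b_Q V_closed Q_in)
  finally show ?thesis
    using assms by (simp add: Q_add b_add V_closed Q_in)
qed

text \<open>The sum vanishes because both its \<open>P\<close>-part and its \<open>Q\<close>-part
  do; the former is the Jacobi identity of \<open>b\<close> at \<open>P x\<close>,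
  \<open>P y\<close>, \<open>P z\<close>.\<close>

lemma br_jacobi:
  assumes "x \<in> V" "y \<in> V" "z \<in> V"
  shows "br x (br y z) + br y (br z x) + br z (br x y) = 0" (is "?J = 0")
proof -
  note jac = lie_bracket_onD(7)[OF lie]
  have "P ?J = b (P x) (b (P y) (P z)) + b (P y) (b (P z) (P x)) + b (P z) (b (P x) (P y))"
    using assms by (simp add: P_add P_br br_in V_closed)
  then have PJ: "P ?J = 0" using jac[OF P_in P_in P_in] assms by simp
  \<comment> \<open>The nine double brackets are sorted by the argument that carries
    \<open>Q\<close>; each row is a Jacobi sum of \<open>b\<close>.\<close>
  have "Q ?J = Q (
      (b (P x) (b (P y) (Q z)) + b (P y) (b (Q z) (P x)) + b (Q z) (b (P x) (P y))) +
      (b (P y) (b (P z) (Q x)) + b (P z) (b (Q x) (P y)) + b (Q x) (b (P y) (P z))) +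
      (b (P z) (b (P x) (Q y)) + b (P x) (b (Q y) (P z)) + b (Q y) (b (P z) (P x))))"
    using assms by (simp add: Q_add Q_br_br br_in V_closed Q_in algebra_simps)
  also have "\<dots> = Q 0" using assms by (simp add: jac P_in Q_in)
  also have "\<dots> = 0" using P_diff[of 0 0] subspace_0[OF V] by (simp add: Q_def)
  finally show ?thesis using PQ_split[of ?J] PJ by simp
qed

lemma lie_bracket_on_br: "lie_bracket_on V br"
  unfolding lie_bracket_on_def
proof (intro conjI ballI allI)
  fix x assume x: "x \<in> V"
  \<comment> \<open>In \<open>br x x\<close> the two mixed terms cancel and the pure term is zero,
    so \<open>Q 0\<close> remains.\<close>
  have "b (Q x) (P x) = - b (P x) (Q x)"
    using x by (intro lie_bracket_on_anticommute[OF lie V]) (simp_all add: P_in Q_in)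
  moreover have "Q 0 = 0" using Q_P[OF subspace_0[OF V]] P_diff[of 0 0] subspace_0[OF V] by simp
  ultimately show "br x x = 0"
    using x by (simp add: br_eq P_in lie_bracket_onD(6)[OF lie])
\<comment> \<open>Closure and Jacobi are settled while \<open>br\<close> is still folded; only
  bilinearity unfolds it.\<close>
qed (simp_all add: br_in br_jacobi, simp_all add: br_def P_add P_scale b_add b_scale V_closed
    scaleR_add_right scaleR_diff_right)

end


section \<open>Smooth functions on manifolds\<close>

locale smooth_mfd =
  fixes M :: "'a manifold"
  assumes M: "smooth_manifold M"
begin

lemma chart_cover: "p \<in> topspace (mtop M) \<Longrightarrow> \<exists>U \<phi>. (U, \<phi>) \<in> charts M \<and> p \<in> U"
  using M unfolding smooth_manifold_def by blast

lemma openin_chart: "(U, \<phi>) \<in> charts M \<Longrightarrow> openin (mtop M) U"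
  using M unfolding smooth_manifold_def by blast

lemma smooth_transition:
  "(U, \<phi>) \<in> charts M \<Longrightarrow> (V, \<psi>) \<in> charts M \<Longrightarrow> i < mdim M \<Longrightarrow>
    Csmooth (mdim M) (\<phi> ` (U \<inter> V)) (\<lambda>x. \<psi> (inv_into U \<phi> x) i)"
  using M unfolding smooth_manifold_def by blast

lemma homeomorphic_chart:
  "(U, \<phi>) \<in> charts M \<Longrightarrow> homeomorphic_map (subtopology (mtop M) U)
     (subtopology (Euclidean_space (mdim M)) (\<phi> ` U)) \<phi>"
  using M unfolding smooth_manifold_def by blast

lemma inj_on_chart: "(U, \<phi>) \<in> charts M \<Longrightarrow> inj_on \<phi> U"
  using homeomorphic_imp_injective_map[OF homeomorphic_chart, of U \<phi>] openin_subset[OF openin_chart, of U \<phi>]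
  by (simp add: Int_absorb1)

lemma chart_inverse [simp]: "(U, \<phi>) \<in> charts M \<Longrightarrow> p \<in> U \<Longrightarrow> inv_into U \<phi> (\<phi> p) = p"
  by (simp add: inj_on_chart)

lemma openin_chart_image:
  assumes "(U, \<phi>) \<in> charts M" "openin (mtop M) W" "W \<subseteq> U"
  shows "openin (Euclidean_space (mdim M)) (\<phi> ` W)"
proof -
  have "openin (subtopology (mtop M) U) W"
    using assms openin_subtopology_alt openin_subset_topspace_eq
    by (metis Int_absorb1 openin_subtopology_Int2)
  then have "openin (subtopology (Euclidean_space (mdim M)) (\<phi> ` U)) (\<phi> ` W)"
    using homeomorphic_chart[OF assms(1)] homeomorphic_map_openness_eq by blast
  moreover have "openin (Euclidean_space (mdim M)) (\<phi> ` U)"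
    using M assms(1) unfolding smooth_manifold_def by blast
  ultimately show ?thesis using openin_trans_full by blast
qed

lemma openin_chart_preimage:
  assumes "(U, \<phi>) \<in> charts M" "openin (Euclidean_space (mdim M)) V" "V \<subseteq> \<phi> ` U"
  shows "openin (mtop M) (inv_into U \<phi> ` V)"
proof -
  let ?W = "inv_into U \<phi> ` V"
  have W: "?W \<subseteq> U" using assms(3) by (auto intro: inv_into_into)
  have im: "\<phi> ` ?W = V" using assms(3) by (rule image_inv_into_cancel[OF refl])
  have "openin (subtopology (Euclidean_space (mdim M)) (\<phi> ` U)) V"
    using assms(2,3) by (metis Int_absorb1 openin_subtopology_Int2)
  then have "openin (subtopology (mtop M) U) ?W"
    using homeomorphic_map_openness[OF homeomorphic_chart[OF assms(1)], of ?W] W im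
      openin_subset[OF openin_chart[OF assms(1)]] by (simp add: topspace_subtopology_subset)
  then show ?thesis using openin_trans_full openin_chart[OF assms(1)] by blast
qed

lemma chart_coordinate_zero:
  "(U, \<phi>) \<in> charts M \<Longrightarrow> p \<in> U \<Longrightarrow> i \<ge> mdim M \<Longrightarrow> \<phi> p i = 0"
  by (rule openin_EuclideanD[OF openin_chart_image[OF _ openin_chart order_refl]]) auto

section \<open>Smooth functions on open sets and near a point\<close>

lemma smooth_fun_subset:
  assumes "smooth_fun M W f" "W' \<subseteq> W"
  shows "smooth_fun M W' f"
  unfolding smooth_fun_def
proof clarify
  fix U \<phi> assume "(U, \<phi>) \<in> charts M"
  then have "Csmooth (mdim M) (\<phi> ` (U \<inter> W)) (\<lambda>x. f (inv_into U \<phi> x))"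
    using assms(1) unfolding smooth_fun_def by blast
  then show "Csmooth (mdim M) (\<phi> ` (U \<inter> W')) (\<lambda>x. f (inv_into U \<phi> x))"
    by (rule Csmooth_subset) (use assms(2) in blast)
qed

text \<open>Inside a chart domain one chart decides: in another chart the local expression is the
  given one composed with the transition map, and \<open>Ck_compose\<close> applies.\<close>

lemma smooth_fun_chart:
  assumes c: "(U, \<phi>) \<in> charts M" and W: "openin (mtop M) W" "W \<subseteq> U"
  shows "smooth_fun M W f \<longleftrightarrow> Csmooth (mdim M) (\<phi> ` W) (\<lambda>x. f (inv_into U \<phi> x))"
proof
  assume "smooth_fun M W f"
  then have "Csmooth (mdim M) (\<phi> ` (U \<inter> W)) (\<lambda>x. f (inv_into U \<phi> x))"
    using c unfolding smooth_fun_def by blast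
  then show "Csmooth (mdim M) (\<phi> ` W) (\<lambda>x. f (inv_into U \<phi> x))"
    using W(2) by (simp add: Int_absorb1)
next
  assume f: "Csmooth (mdim M) (\<phi> ` W) (\<lambda>x. f (inv_into U \<phi> x))"
  have "Csmooth (mdim M) (\<psi> ` (V \<inter> W)) (\<lambda>x. f (inv_into V \<psi> x))" if d: "(V, \<psi>) \<in> charts M" for V \<psi>
  proof -
    let ?S = "\<psi> ` (V \<inter> W)"
    have S: "openin (Euclidean_space (mdim M)) ?S"
      using openin_chart[OF d] W by (intro openin_chart_image[OF d]) auto
    have T: "openin (Euclidean_space (mdim M)) (\<phi> ` W)"
      by (rule openin_chart_image[OF c W])
    have im: "(\<lambda>x. \<phi> (inv_into V \<psi> x)) ` ?S \<subseteq> \<phi> ` W" using d by auto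
    have g: "Ck (mdim M) k ?S (\<lambda>x. \<phi> (inv_into V \<psi> x) j)" if "j < mdim M" for j k
    proof -
      have "Csmooth (mdim M) ?S (\<lambda>x. \<phi> (inv_into V \<psi> x) j)"
        by (rule Csmooth_subset[OF smooth_transition[OF d c that]]) (use W(2) in blast)
      then show ?thesis unfolding Csmooth_def ..
    qed
    have "Csmooth (mdim M) ?S (\<lambda>x. f (inv_into U \<phi> (\<phi> (inv_into V \<psi> x))))"
      unfolding Csmooth_def
    proof
      fix k
      have "Ck (mdim M) k (\<phi> ` W) (\<lambda>x. f (inv_into U \<phi> x))"
        using f unfolding Csmooth_def ..
      then show "Ck (mdim M) k ?S (\<lambda>x. f (inv_into U \<phi> (\<phi> (inv_into V \<psi> x))))"
        by (rule Ck_compose[OF S T im _ g])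
    qed
    moreover have "f (inv_into U \<phi> (\<phi> (inv_into V \<psi> x))) = f (inv_into V \<psi> x)" if "x \<in> ?S" for x
      using that c d W(2) by auto
    ultimately show ?thesis by (subst (asm) Csmooth_cong[OF S])
  qed
  then show "smooth_fun M W f" unfolding smooth_fun_def by blast
qed

lemma openin_chart_Int_image:
  "(U, \<phi>) \<in> charts M \<Longrightarrow> openin (mtop M) W \<Longrightarrow> openin (Euclidean_space (mdim M)) (\<phi> ` (U \<inter> W))"
  by (rule openin_chart_image) (auto simp: openin_chart)

lemma smooth_fun_cong:
  assumes "openin (mtop M) W" "\<And>p. p \<in> W \<Longrightarrow> f p = g p"
  shows "smooth_fun M W f \<longleftrightarrow> smooth_fun M W g"
proof -
  have "Csmooth (mdim M) (\<phi> ` (U \<inter> W)) (\<lambda>x. f (inv_into U \<phi> x)) \<longleftrightarrow>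
      Csmooth (mdim M) (\<phi> ` (U \<inter> W)) (\<lambda>x. g (inv_into U \<phi> x))" if "(U, \<phi>) \<in> charts M" for U \<phi>
    using assms(2) that by (intro Csmooth_cong openin_chart_Int_image assms(1)) auto
  then show ?thesis unfolding smooth_fun_def by blast
qed

lemma smooth_funI:
  assumes "\<And>U \<phi> k. (U, \<phi>) \<in> charts M \<Longrightarrow> openin (Euclidean_space (mdim M)) (\<phi> ` (U \<inter> W)) \<Longrightarrow>
      Ck (mdim M) k (\<phi> ` (U \<inter> W)) (\<lambda>x. f (inv_into U \<phi> x))"
    and "openin (mtop M) W"
  shows "smooth_fun M W f"
  unfolding smooth_fun_def Csmooth_def
proof clarify
  fix U \<phi> k assume c: "(U, \<phi>) \<in> charts M"
  show "Ck (mdim M) k (\<phi> ` (U \<inter> W)) (\<lambda>x. f (inv_into U \<phi> x))"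
    by (rule assms(1)[OF c openin_chart_Int_image[OF c assms(2)]])
qed

lemma smooth_funD:
  "smooth_fun M W f \<Longrightarrow> (U, \<phi>) \<in> charts M \<Longrightarrow> Ck (mdim M) k (\<phi> ` (U \<inter> W)) (\<lambda>x. f (inv_into U \<phi> x))"
  unfolding smooth_fun_def Csmooth_def by blast

lemma smooth_fun_const: "openin (mtop M) W \<Longrightarrow> smooth_fun M W (\<lambda>x. c)"
  by (rule smooth_funI) (rule Ck_const)

lemma smooth_fun_add:
  assumes "openin (mtop M) W" "smooth_fun M W f" "smooth_fun M W g"
  shows "smooth_fun M W (\<lambda>x. f x + g x)"
  by (rule smooth_funI[OF _ assms(1)])
    (rule Ck_add[OF _ smooth_funD[OF assms(2)] smooth_funD[OF assms(3)]])

lemma smooth_fun_mult: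
  assumes "openin (mtop M) W" "smooth_fun M W f" "smooth_fun M W g"
  shows "smooth_fun M W (\<lambda>x. f x * g x)"
  by (rule smooth_funI[OF _ assms(1)])
    (rule Ck_mult[OF _ smooth_funD[OF assms(2)] smooth_funD[OF assms(3)]])

lemma smooth_fun_sum:
  assumes "openin (mtop M) W" "\<And>j. j \<in> J \<Longrightarrow> smooth_fun M W (f j)"
  shows "smooth_fun M W (\<lambda>x. \<Sum>j\<in>J. f j x)"
  by (rule smooth_funI[OF _ assms(1)]) (rule Ck_sum[OF _ smooth_funD[OF assms(2)]])

lemma smooth_fun_diff:
  assumes "openin (mtop M) W" "smooth_fun M W f" "smooth_fun M W g"
  shows "smooth_fun M W (\<lambda>x. f x - g x)"
  using smooth_fun_add[OF assms(1,2) smooth_fun_mult[OF assms(1) smooth_fun_const[OF assms(1)] assms(3)], of "- 1"]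
  by simp

lemma smooth_near_fun: "smooth_fun M W f \<Longrightarrow> openin (mtop M) W \<Longrightarrow> p \<in> W \<Longrightarrow> smooth_near M p f"
  unfolding smooth_near_def by (intro exI conjI)

lemma smooth_near_topspace: "smooth_near M p f \<Longrightarrow> p \<in> topspace (mtop M)"
  unfolding smooth_near_def by (auto dest: openin_subset)

lemma smooth_fun_local:
  assumes "openin (mtop M) W" "\<And>p. p \<in> W \<Longrightarrow> smooth_near M p f"
  shows "smooth_fun M W f"
  unfolding smooth_fun_def
proof (clarify intro!: Csmooth_local)
  fix U \<phi> assume c: "(U, \<phi>) \<in> charts M"
  show "Csmooth (mdim M) (\<phi> ` (U \<inter> W)) (\<lambda>x. f (inv_into U \<phi> x))"
  proof (rule Csmooth_local[OF openin_chart_Int_image[OF c assms(1)]])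
    fix x assume "x \<in> \<phi> ` (U \<inter> W)"
    then obtain p where p: "p \<in> U" "p \<in> W" "x = \<phi> p" by blast
    with assms(2) obtain V where V: "openin (mtop M) V" "p \<in> V" "smooth_fun M V f"
      unfolding smooth_near_def by blast
    then have "Csmooth (mdim M) (\<phi> ` (U \<inter> V)) (\<lambda>x. f (inv_into U \<phi> x))"
      using c unfolding smooth_fun_def by blast
    then show "\<exists>S. openin (Euclidean_space (mdim M)) S \<and> x \<in> S \<and>
        Csmooth (mdim M) S (\<lambda>x. f (inv_into U \<phi> x))"
      using openin_chart_Int_image[OF c V(1)] p V(2) by blast
  qed
qed

lemma smooth_near_cong:
  assumes "smooth_near M p f" "openin (mtop M) W" "p \<in> W" "\<And>q. q \<in> W \<Longrightarrow> f q = g q"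
  shows "smooth_near M p g"
proof -
  obtain V where V: "openin (mtop M) V" "p \<in> V" "smooth_fun M V f"
    using assms(1) unfolding smooth_near_def by blast
  have "openin (mtop M) (V \<inter> W)" using V assms(2) by blast
  moreover from this have "smooth_fun M (V \<inter> W) g"
    using smooth_fun_cong[of "V \<inter> W" f g] smooth_fun_subset[OF V(3), of "V \<inter> W"] assms(4) by blast
  ultimately show ?thesis using V(2) assms(3) smooth_near_fun by blast
qed

lemma smooth_near_common:
  assumes "smooth_near M p f" "smooth_near M p g"
  obtains W where "openin (mtop M) W" "p \<in> W" "smooth_fun M W f" "smooth_fun M W g"
proof -
  obtain V W where VW: "openin (mtop M) V" "p \<in> V" "smooth_fun M V f"
      "openin (mtop M) W" "p \<in> W" "smooth_fun M W g"
    using assms unfolding smooth_near_def by blast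
  show ?thesis
    by (rule that[of "V \<inter> W"])
      (use VW smooth_fun_subset[OF VW(3), of "V \<inter> W"] smooth_fun_subset[OF VW(6), of "V \<inter> W"] in auto)
qed

lemma smooth_near_const: "p \<in> topspace (mtop M) \<Longrightarrow> smooth_near M p (\<lambda>x. c)"
  by (rule smooth_near_fun[OF smooth_fun_const[OF openin_topspace] openin_topspace])

lemma smooth_near_add:
  assumes "smooth_near M p f" "smooth_near M p g" shows "smooth_near M p (\<lambda>x. f x + g x)"
proof -
  obtain W where W: "openin (mtop M) W" "p \<in> W" "smooth_fun M W f" "smooth_fun M W g"
    by (rule smooth_near_common[OF assms])
  show ?thesis by (rule smooth_near_fun[OF smooth_fun_add[OF W(1,3,4)] W(1,2)])
qed

lemma smooth_near_mult:
  assumes "smooth_near M p f" "smooth_near M p g" shows "smooth_near M p (\<lambda>x. f x * g x)"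
proof -
  obtain W where W: "openin (mtop M) W" "p \<in> W" "smooth_fun M W f" "smooth_fun M W g"
    by (rule smooth_near_common[OF assms])
  show ?thesis by (rule smooth_near_fun[OF smooth_fun_mult[OF W(1,3,4)] W(1,2)])
qed

lemma smooth_near_diff:
  assumes "smooth_near M p f" "smooth_near M p g" shows "smooth_near M p (\<lambda>x. f x - g x)"
proof -
  obtain W where W: "openin (mtop M) W" "p \<in> W" "smooth_fun M W f" "smooth_fun M W g"
    by (rule smooth_near_common[OF assms])
  show ?thesis by (rule smooth_near_fun[OF smooth_fun_diff[OF W(1,3,4)] W(1,2)])
qed

lemma smooth_near_sum:
  assumes "p \<in> topspace (mtop M)" "\<And>j. j \<in> J \<Longrightarrow> smooth_near M p (f j)"
  shows "smooth_near M p (\<lambda>x. \<Sum>j\<in>J. f j x)"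
  using assms(2)
  by (induction J rule: infinite_finite_induct)
    (simp_all add: smooth_near_const[OF assms(1)] smooth_near_add del: sum.cong_simp)

lemma smooth_fun_coordinate:
  assumes c: "(U, \<phi>) \<in> charts M"
  shows "smooth_fun M U (\<lambda>x. \<phi> x i)"
proof -
  have S: "openin (Euclidean_space (mdim M)) (\<phi> ` U)"
    by (rule openin_chart_image[OF c openin_chart[OF c] order_refl])
  have "Csmooth (mdim M) (\<phi> ` U) (\<lambda>x. \<phi> (inv_into U \<phi> x) i) \<longleftrightarrow> Csmooth (mdim M) (\<phi> ` U) (\<lambda>x. x i)"
    by (rule Csmooth_cong[OF S]) (simp add: f_inv_into_f)
  then show ?thesis
    using smooth_fun_chart[OF c openin_chart[OF c] order_refl] Ck_coordinate[OF S]
    unfolding Csmooth_def by blast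
qed

lemma smooth_near_coordinate:
  assumes "(U, \<phi>) \<in> charts M" "p \<in> U" shows "smooth_near M p (\<lambda>x. \<phi> x i)"
  by (rule smooth_near_fun[OF smooth_fun_coordinate[OF assms(1)] openin_chart[OF assms(1)] assms(2)])

lemma smooth_near_chart:
  assumes c: "(U, \<phi>) \<in> charts M" "p \<in> U" and f: "smooth_near M p f"
  obtains W where "openin (mtop M) W" "p \<in> W" "W \<subseteq> U" "smooth_fun M W f"
    "openin (Euclidean_space (mdim M)) (\<phi> ` W)"
    "Csmooth (mdim M) (\<phi> ` W) (\<lambda>x. f (inv_into U \<phi> x))"
proof -
  obtain V where V: "openin (mtop M) V" "p \<in> V" "smooth_fun M V f"
    using f unfolding smooth_near_def by blast
  have W: "openin (mtop M) (V \<inter> U)" "V \<inter> U \<subseteq> U" using V(1) openin_chart[OF c(1)] by auto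
  have s: "smooth_fun M (V \<inter> U) f" using V(3) by (rule smooth_fun_subset) auto
  have "Csmooth (mdim M) (\<phi> ` (V \<inter> U)) (\<lambda>x. f (inv_into U \<phi> x))"
    using smooth_fun_chart[OF c(1) W, of f] s by simp
  from that[OF W(1) _ W(2) s openin_chart_image[OF c(1) W] this] show ?thesis
    using V(2) c(2) by simp
qed


section \<open>Tangent vectors in a chart\<close>

lemma tangent_spaceD:
  assumes "v \<in> tangent_space M p"
  shows "\<forall>f. \<not> smooth_near M p f \<longrightarrow> v f = 0"
    and "\<forall>f g W. smooth_near M p f \<and> smooth_near M p g \<and>
       openin (mtop M) W \<and> p \<in> W \<and> (\<forall>x\<in>W. f x = g x) \<longrightarrow> v f = v g"
    and "\<forall>c f. smooth_near M p f \<longrightarrow> v (\<lambda>x. c * f x) = c * v f"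
    and "\<forall>f g. smooth_near M p f \<and> smooth_near M p g \<longrightarrow>
       v (\<lambda>x. f x + g x) = v f + v g \<and>
       v (\<lambda>x. f x * g x) = f p * v g + g p * v f"
proof -
  note * = assms[unfolded tangent_space_def mem_Collect_eq]
  show "\<forall>f. \<not> smooth_near M p f \<longrightarrow> v f = 0"
    by (rule *[THEN conjunct1])
  show "\<forall>f g W. smooth_near M p f \<and> smooth_near M p g \<and>
       openin (mtop M) W \<and> p \<in> W \<and> (\<forall>x\<in>W. f x = g x) \<longrightarrow> v f = v g"
    by (rule *[THEN conjunct2, THEN conjunct1])
  show "\<forall>c f. smooth_near M p f \<longrightarrow> v (\<lambda>x. c * f x) = c * v f"
    by (rule *[THEN conjunct2, THEN conjunct2, THEN conjunct1])
  show "\<forall>f g. smooth_near M p f \<and> smooth_near M p g \<longrightarrow>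
       v (\<lambda>x. f x + g x) = v f + v g \<and>
       v (\<lambda>x. f x * g x) = f p * v g + g p * v f"
    by (rule *[THEN conjunct2, THEN conjunct2, THEN conjunct2])
qed

lemma tangent_zero: "v \<in> tangent_space M p \<Longrightarrow> \<not> smooth_near M p f \<Longrightarrow> v f = 0"
  by (drule tangent_spaceD(1)[THEN spec, THEN mp])

lemma tangent_cong:
  assumes "v \<in> tangent_space M p" "smooth_near M p f" "openin (mtop M) W" "p \<in> W"
    "\<And>q. q \<in> W \<Longrightarrow> f q = g q"
  shows "v f = v g"
  by (rule tangent_spaceD(2)[OF assms(1), THEN spec, THEN spec, THEN spec, THEN mp, of f g W])
    (use assms(2-5) smooth_near_cong[OF assms(2-5)] in simp)

lemma tangent_cmult: "v \<in> tangent_space M p \<Longrightarrow> smooth_near M p f \<Longrightarrow> v (\<lambda>x. c * f x) = c * v f"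
  by (rule tangent_spaceD(3)[THEN spec, THEN spec, THEN mp])

lemma tangent_add:
  "v \<in> tangent_space M p \<Longrightarrow> smooth_near M p f \<Longrightarrow> smooth_near M p g \<Longrightarrow> v (\<lambda>x. f x + g x) = v f + v g"
  by (rule tangent_spaceD(4)[THEN spec, THEN spec, THEN mp, THEN conjunct1, OF _ conjI])

lemma tangent_mult:
  "v \<in> tangent_space M p \<Longrightarrow> smooth_near M p f \<Longrightarrow> smooth_near M p g \<Longrightarrow>
    v (\<lambda>x. f x * g x) = f p * v g + g p * v f"
  by (rule tangent_spaceD(4)[THEN spec, THEN spec, THEN mp, THEN conjunct2, OF _ conjI])

lemma tangent_spaceI:
  assumes "\<And>f. \<not> smooth_near M p f \<Longrightarrow> v f = 0"
    and "\<And>f g W. smooth_near M p f \<Longrightarrow> openin (mtop M) W \<Longrightarrow> p \<in> W \<Longrightarrow>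
      (\<And>x. x \<in> W \<Longrightarrow> f x = g x) \<Longrightarrow> v f = v g"
    and "\<And>c f. smooth_near M p f \<Longrightarrow> v (\<lambda>x. c * f x) = c * v f"
    and "\<And>f g. smooth_near M p f \<Longrightarrow> smooth_near M p g \<Longrightarrow> v (\<lambda>x. f x + g x) = v f + v g"
    and "\<And>f g. smooth_near M p f \<Longrightarrow> smooth_near M p g \<Longrightarrow> v (\<lambda>x. f x * g x) = f p * v g + g p * v f"
  shows "v \<in> tangent_space M p"
  unfolding tangent_space_def mem_Collect_eq
proof (intro conjI allI impI; (elim conjE)?)
  fix f g W assume "smooth_near M p f" "openin (mtop M) W" "p \<in> W" "\<forall>x\<in>W. f x = g x"
  then show "v f = v g" using assms(2)[of f W g] by simp
qed (fact assms(1,3-5))+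

lemma tangent_diff:
  assumes "v \<in> tangent_space M p" "smooth_near M p f" "smooth_near M p g"
  shows "v (\<lambda>x. f x - g x) = v f - v g"
proof -
  have "smooth_near M p (\<lambda>x. - 1 * g x)"
    by (rule smooth_near_mult[OF smooth_near_const[OF smooth_near_topspace] assms(3)]) fact
  from tangent_add[OF assms(1,2) this] tangent_cmult[OF assms(1,3), of "- 1"] show ?thesis by simp
qed

lemma tangent_const:
  assumes "v \<in> tangent_space M p" "p \<in> topspace (mtop M)"
  shows "v (\<lambda>x. c) = 0"
proof -
  \<comment> \<open>The Leibniz rule for \<open>1 = 1 * 1\<close> says that this value equals twice
    itself.\<close>
  have "v (\<lambda>x. 1) = 0"
    using tangent_mult[OF assms(1) smooth_near_const[OF assms(2)] smooth_near_const[OF assms(2)], of 1 1]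
    by simp
  then show ?thesis
    using tangent_cmult[OF assms(1) smooth_near_const[OF assms(2)], of c 1] by simp
qed

lemma tangent_sum:
  assumes "v \<in> tangent_space M p" "p \<in> topspace (mtop M)" "\<And>j. j \<in> J \<Longrightarrow> smooth_near M p (f j)"
  shows "v (\<lambda>x. \<Sum>j\<in>J. f j x) = (\<Sum>j\<in>J. v (f j))"
  using assms(3)
proof (induction J rule: infinite_finite_induct)
  case (insert a J)
  then have "v (\<lambda>x. f a x + (\<Sum>j\<in>J. f j x)) = v (f a) + v (\<lambda>x. \<Sum>j\<in>J. f j x)"
    using assms(1,2) by (intro tangent_add[of v p "f a"] smooth_near_sum) auto
  with insert show ?case by simp
qed (use tangent_const[OF assms(1,2)] in auto)

text \<open>Expand \<open>f\<close> around \<open>p\<close> by Hadamard and apply the Leibniz rule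
  to each product. The factor \<open>\<phi> q i - \<phi> p i\<close> vanishes at \<open>p\<close>,
  so \<open>v (H i)\<close> drops out and only the central value of \<open>H i\<close>, a partial
  derivative of \<open>f\<close>, survives. Smoothness of \<open>H i\<close> is what admits the
  Leibniz rule.\<close>

lemma tangent_formula:
  assumes c: "(U, \<phi>) \<in> charts M" "p \<in> U" and v: "v \<in> tangent_space M p" and f: "smooth_near M p f"
  shows "v f = (\<Sum>i<mdim M. v (\<lambda>x. \<phi> x i) * partial i (\<lambda>x. f (inv_into U \<phi> x)) (\<phi> p))"
proof -
  let ?n = "mdim M" and ?F = "\<lambda>x. f (inv_into U \<phi> x)" and ?y = "\<phi> p"
  obtain W where W: "openin (mtop M) W" "p \<in> W" "W \<subseteq> U" "smooth_fun M W f"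
    "openin (Euclidean_space ?n) (\<phi> ` W)" "Csmooth ?n (\<phi> ` W) ?F"
    by (rule smooth_near_chart[OF c f])
  obtain e where e: "e > 0" "cube ?n ?y e \<subseteq> \<phi> ` W"
    using openin_Euclidean_imp_cube[OF W(5), of ?y] W(2) by blast
  let ?C = "cube ?n ?y e"
  \<comment> \<open>The part of the chart domain on which the expansion is valid; \<open>v\<close>
    sees only the germ at \<open>p\<close>, so equality on \<open>V\<close> suffices.\<close>
  define V where "V = inv_into U \<phi> ` ?C"
  have CU: "?C \<subseteq> \<phi> ` U" using e(2) W(3) by blast
  have yC: "?y \<in> ?C" using e(1) chart_coordinate_zero[OF c] by (auto simp: cube_def)
  have V: "openin (mtop M) V"
    unfolding V_def by (rule openin_chart_preimage[OF c(1) openin_cube CU])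
  have VU: "V \<subseteq> U" using CU unfolding V_def by (auto intro: inv_into_into)
  have V_im: "\<phi> ` V = ?C" unfolding V_def by (rule image_inv_into_cancel[OF refl CU])
  have pV: "p \<in> V" using yC c unfolding V_def by force
  have pM: "p \<in> topspace (mtop M)" using smooth_near_topspace[OF f] .
  define H where "H i q = hadamard ?y ?F i (\<phi> q)" for i q
  have FC: "Ck ?n k ?C ?F" for k
    using Csmooth_subset[OF W(6) e(2)] unfolding Csmooth_def by simp
  have H: "smooth_near M p (H i)" if "i < ?n" for i
  proof -
    have "Csmooth ?n ?C (hadamard ?y ?F i)"
      unfolding Csmooth_def by (rule allI, rule Ck_hadamard[OF yC FC that])
    moreover have "hadamard ?y ?F i x = H i (inv_into U \<phi> x)" if "x \<in> ?C" for x
      using that CU by (simp add: H_def f_inv_into_f subset_iff)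
    ultimately have "Csmooth ?n ?C (\<lambda>x. H i (inv_into U \<phi> x))"
      using Csmooth_cong[OF openin_cube, of ?n ?y e "hadamard ?y ?F i" "\<lambda>x. H i (inv_into U \<phi> x)"] by simp
    then have "smooth_fun M V (H i)" using smooth_fun_chart[OF c(1) V VU] V_im by simp
    then show ?thesis using V pV by (rule smooth_near_fun)
  qed
  have K: "smooth_near M p (\<lambda>q. \<phi> q i - \<phi> p i)" for i
    by (intro smooth_near_diff smooth_near_coordinate[OF c] smooth_near_const pM)
  have KH: "smooth_near M p (\<lambda>q. (\<phi> q i - \<phi> p i) * H i q)" if "i < ?n" for i
    by (intro smooth_near_mult K H that)
  have "v f = v (\<lambda>q. f p + (\<Sum>i<?n. (\<phi> q i - \<phi> p i) * H i q))"
  proof (rule tangent_cong[OF v f V pV])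
    fix q assume q: "q \<in> V"
    then have "\<phi> q \<in> ?C" using V_im by blast
    from hadamard_expansion[OF yC FC this] show "f q = f p + (\<Sum>i<?n. (\<phi> q i - \<phi> p i) * H i q)"
      using c q VU by (simp add: H_def subset_iff)
  qed
  also have "\<dots> = v (\<lambda>q. f p) + v (\<lambda>q. \<Sum>i<?n. (\<phi> q i - \<phi> p i) * H i q)"
    using KH by (intro tangent_add[OF v] smooth_near_const smooth_near_sum pM) auto
  also have "\<dots> = (\<Sum>i<?n. v (\<lambda>q. (\<phi> q i - \<phi> p i) * H i q))"
    using KH tangent_sum[OF v pM, of "{..<?n}" "\<lambda>i q. (\<phi> q i - \<phi> p i) * H i q"]
    by (simp add: tangent_const[OF v pM])
  also have "\<dots> = (\<Sum>i<?n. v (\<lambda>x. \<phi> x i) * partial i ?F ?y)"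
  proof (rule sum.cong[OF refl])
    fix i assume "i \<in> {..<?n}"
    then have i: "i < ?n" by simp
    have "v (\<lambda>q. (\<phi> q i - \<phi> p i) * H i q) = (\<phi> p i - \<phi> p i) * v (H i) + H i p * v (\<lambda>q. \<phi> q i - \<phi> p i)"
      by (rule tangent_mult[OF v K H[OF i]])
    also have "v (\<lambda>q. \<phi> q i - \<phi> p i) = v (\<lambda>q. \<phi> q i)"
      using tangent_diff[OF v smooth_near_coordinate[OF c] smooth_near_const[OF pM]]
      by (simp add: tangent_const[OF v pM])
    finally show "v (\<lambda>q. (\<phi> q i - \<phi> p i) * H i q) = v (\<lambda>x. \<phi> x i) * partial i ?F ?y"
      by (simp add: H_def hadamard_center)
  qed
  finally show ?thesis .
qed

text \<open>The derivation with components \<open>a\<close> in the given chart, that is, the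
  combination of the coordinate derivatives at \<open>p\<close> with coefficients
  \<open>a i\<close>. Only the first \<open>mdim M\<close> entries of \<open>a\<close> count, and
  the guard enforces the convention for functions not smooth near \<open>p\<close>.\<close>

definition chart_tangent :: "'a set \<Rightarrow> ('a \<Rightarrow> nat \<Rightarrow> real) \<Rightarrow> 'a \<Rightarrow> (nat \<Rightarrow> real) \<Rightarrow> 'a tvec"
  where "chart_tangent U \<phi> p a = (\<lambda>f. if smooth_near M p f
    then \<Sum>i<mdim M. a i * partial i (\<lambda>x. f (inv_into U \<phi> x)) (\<phi> p) else 0)"

lemma chart_has_partial:
  assumes "(U, \<phi>) \<in> charts M" "p \<in> U" "smooth_near M p f" "i < mdim M"
  shows "((\<lambda>t. f (inv_into U \<phi> ((\<phi> p)(i := t)))) has_field_derivative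
    partial i (\<lambda>x. f (inv_into U \<phi> x)) (\<phi> p)) (at (\<phi> p i))"
proof -
  obtain W where "p \<in> W" "Csmooth (mdim M) (\<phi> ` W) (\<lambda>x. f (inv_into U \<phi> x))"
    by (rule smooth_near_chart[OF assms(1-3)])
  then show ?thesis by (intro Csmooth_has_partial[of "mdim M" "\<phi> ` W"] imageI assms(4))
qed

lemma chart_tangent_in:
  assumes c: "(U, \<phi>) \<in> charts M" "p \<in> U"
  shows "chart_tangent U \<phi> p a \<in> tangent_space M p"
proof (rule tangent_spaceI)
  fix f assume "\<not> smooth_near M p f"
  then show "chart_tangent U \<phi> p a f = 0" by (simp add: chart_tangent_def)
next
  fix f g W
  assume f: "smooth_near M p f" and W: "openin (mtop M) W" "p \<in> W" "\<And>x. x \<in> W \<Longrightarrow> f x = g x"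
  have "partial i (\<lambda>x. f (inv_into U \<phi> x)) (\<phi> p) = partial i (\<lambda>x. g (inv_into U \<phi> x)) (\<phi> p)"
    if "i < mdim M" for i
    using c(2) that W openin_chart_Int_image[OF c(1) W(1)]
    by (intro partial_cong[of "mdim M" "\<phi> ` (U \<inter> W)"]) (auto simp: chart_inverse[OF c(1)])
  then show "chart_tangent U \<phi> p a f = chart_tangent U \<phi> p a g"
    using f smooth_near_cong[OF f W] by (simp add: chart_tangent_def)
next
  fix r f assume f: "smooth_near M p f"
  then have "smooth_near M p (\<lambda>x. r * f x)"
    by (intro smooth_near_mult smooth_near_const smooth_near_topspace[OF f])
  moreover have "partial i (\<lambda>x. r * f (inv_into U \<phi> x)) (\<phi> p) =
      r * partial i (\<lambda>x. f (inv_into U \<phi> x)) (\<phi> p)" if "i < mdim M" for i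
    by (rule partialI, rule DERIV_cmult, rule chart_has_partial[OF c f that])
  ultimately show "chart_tangent U \<phi> p a (\<lambda>x. r * f x) = r * chart_tangent U \<phi> p a f"
    using f by (simp add: chart_tangent_def sum_distrib_left mult_ac)
next
  fix f g assume f: "smooth_near M p f" and g: "smooth_near M p g"
  have "partial i (\<lambda>x. f (inv_into U \<phi> x) + g (inv_into U \<phi> x)) (\<phi> p) =
      partial i (\<lambda>x. f (inv_into U \<phi> x)) (\<phi> p) + partial i (\<lambda>x. g (inv_into U \<phi> x)) (\<phi> p)"
    if "i < mdim M" for i
    by (rule partialI, rule DERIV_add[OF chart_has_partial[OF c f that] chart_has_partial[OF c g that]])
  then show "chart_tangent U \<phi> p a (\<lambda>x. f x + g x) = chart_tangent U \<phi> p a f + chart_tangent U \<phi> p a g"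
    using f g smooth_near_add[OF f g] by (simp add: chart_tangent_def sum.distrib distrib_left)
next
  fix f g assume f: "smooth_near M p f" and g: "smooth_near M p g"
  have "partial i (\<lambda>x. f (inv_into U \<phi> x) * g (inv_into U \<phi> x)) (\<phi> p) =
      partial i (\<lambda>x. f (inv_into U \<phi> x)) (\<phi> p) * g p + partial i (\<lambda>x. g (inv_into U \<phi> x)) (\<phi> p) * f p"
    if "i < mdim M" for i
    using partialI[OF DERIV_mult[OF chart_has_partial[OF c f that] chart_has_partial[OF c g that]]]
    unfolding fun_upd_triv chart_inverse[OF c] .
  then show "chart_tangent U \<phi> p a (\<lambda>x. f x * g x) = f p * chart_tangent U \<phi> p a g + g p * chart_tangent U \<phi> p a f"
    using f g smooth_near_mult[OF f g]
    by (simp add: chart_tangent_def sum.distrib[symmetric] sum_distrib_left algebra_simps)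
qed

lemma chart_tangent_coordinate:
  assumes c: "(U, \<phi>) \<in> charts M" "p \<in> U" and j: "j < mdim M"
  shows "chart_tangent U \<phi> p a (\<lambda>x. \<phi> x j) = a j"
proof -
  have "partial i (\<lambda>x. \<phi> (inv_into U \<phi> x) j) (\<phi> p) = (if i = j then 1 else 0)" if "i < mdim M" for i
  proof -
    have "partial i (\<lambda>x. \<phi> (inv_into U \<phi> x) j) (\<phi> p) = partial i (\<lambda>x. x j) (\<phi> p)"
      using c that openin_chart_image[OF c(1) openin_chart[OF c(1)] order_refl]
      by (intro partial_cong[of "mdim M" "\<phi> ` U"]) (auto simp: f_inv_into_f)
    also have "\<dots> = (if i = j then 1 else 0)"
      by (rule partialI) (auto intro!: derivative_eq_intros)
    finally show ?thesis .
  qed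
  then have "chart_tangent U \<phi> p a (\<lambda>x. \<phi> x j) = (\<Sum>i<mdim M. a i * (if i = j then 1 else 0))"
    using smooth_near_coordinate[OF c] by (simp add: chart_tangent_def)
  also have "\<dots> = a j" using j by (simp add: if_distrib cong: if_cong)
  finally show ?thesis .
qed

lemma tangent_eqI:
  assumes c: "(U, \<phi>) \<in> charts M" "p \<in> U"
    and v: "v \<in> tangent_space M p" and w: "w \<in> tangent_space M p"
    and eq: "\<And>i. i < mdim M \<Longrightarrow> v (\<lambda>x. \<phi> x i) = w (\<lambda>x. \<phi> x i)"
  shows "v = w"
proof
  fix f show "v f = w f"
    using tangent_zero[OF v] tangent_zero[OF w] tangent_formula[OF c v] tangent_formula[OF c w] eq
    by (cases "smooth_near M p f") auto
qed

lemma subspace_tangent_space: "subspace (tangent_space M p)"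
proof -
  have "(\<lambda>f. 0) \<in> tangent_space M p" by (rule tangent_spaceI) simp_all
  moreover have "(\<lambda>f. v f + w f) \<in> tangent_space M p"
    if v: "v \<in> tangent_space M p" and w: "w \<in> tangent_space M p" for v w
  proof (rule tangent_spaceI)
    fix f g W assume "smooth_near M p f" "openin (mtop M) W" "p \<in> W" "\<And>x. x \<in> W \<Longrightarrow> f x = g x"
    from tangent_cong[OF v this] tangent_cong[OF w this] show "v f + w f = v g + w g" by simp
  qed (simp_all add: tangent_zero[OF v] tangent_zero[OF w] tangent_cmult[OF v] tangent_cmult[OF w]
      tangent_add[OF v] tangent_add[OF w] tangent_mult[OF v] tangent_mult[OF w] algebra_simps)
  moreover have "(\<lambda>f. r * v f) \<in> tangent_space M p" if v: "v \<in> tangent_space M p" for r v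
  proof (rule tangent_spaceI)
    fix f g W assume "smooth_near M p f" "openin (mtop M) W" "p \<in> W" "\<And>x. x \<in> W \<Longrightarrow> f x = g x"
    from tangent_cong[OF v this] show "r * v f = r * v g" by simp
  qed (simp_all add: tangent_zero[OF v] tangent_cmult[OF v] tangent_add[OF v] tangent_mult[OF v]
      algebra_simps)
  ultimately show ?thesis
    unfolding subspace_def zero_fun_def plus_fun_def scaleR_fun_def by simp
qed

lemma tangent_coordinate_zero:
  assumes c: "(U, \<phi>) \<in> charts M" "p \<in> U" and v: "v \<in> tangent_space M p" and i: "i \<ge> mdim M"
  shows "v (\<lambda>x. \<phi> x i) = 0"
proof -
  have "v (\<lambda>x. \<phi> x i) = v (\<lambda>x. 0)"
    using c chart_coordinate_zero[OF c(1) _ i]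
    by (intro tangent_cong[OF v smooth_near_coordinate[OF c] openin_chart[OF c(1)] c(2)])
  also have "\<dots> = 0" using v c openin_subset[OF openin_chart[OF c(1)]] by (intro tangent_const) auto
  finally show ?thesis .
qed

text \<open>Injectivity is \<open>tangent_formula\<close>: the components determine a derivation.
  For surjectivity, \<open>chart_tangent\<close> realises any prescribed components; those from
  \<open>mdim M\<close> on are 0 on both sides.\<close>

lemma bij_betw_chart_coordinates:
  assumes c: "(U, \<phi>) \<in> charts M" "p \<in> U"
  shows "bij_betw (\<lambda>v i. v (\<lambda>x. \<phi> x i)) (tangent_space M p) (topspace (Euclidean_space (mdim M)))"
  unfolding bij_betw_def
proof
  show "inj_on (\<lambda>v i. v (\<lambda>x. \<phi> x i)) (tangent_space M p)"
    by (rule inj_onI, rule tangent_eqI[OF c]) (auto dest: fun_cong)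
  show "(\<lambda>v i. v (\<lambda>x. \<phi> x i)) ` tangent_space M p = topspace (Euclidean_space (mdim M))"
  proof
    show "(\<lambda>v i. v (\<lambda>x. \<phi> x i)) ` tangent_space M p \<subseteq> topspace (Euclidean_space (mdim M))"
      using tangent_coordinate_zero[OF c] by (auto simp: topspace_Euclidean_space)
    show "topspace (Euclidean_space (mdim M)) \<subseteq> (\<lambda>v i. v (\<lambda>x. \<phi> x i)) ` tangent_space M p"
    proof
      fix a assume a: "a \<in> topspace (Euclidean_space (mdim M))"
      have "a i = chart_tangent U \<phi> p a (\<lambda>x. \<phi> x i)" for i
      proof (cases "i < mdim M")
        case True
        then show ?thesis by (simp add: chart_tangent_coordinate[OF c])
      next
        case False
        then show ?thesis using a tangent_coordinate_zero[OF c chart_tangent_in[OF c]]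
          by (simp add: topspace_Euclidean_space)
      qed
      then show "a \<in> (\<lambda>v i. v (\<lambda>x. \<phi> x i)) ` tangent_space M p"
        using chart_tangent_in[OF c] by blast
    qed
  qed
qed

section \<open>The tangent bundle as a vector bundle\<close>

abbreviation chart_triv :: "('a \<Rightarrow> nat \<Rightarrow> real) \<Rightarrow> 'a \<Rightarrow> 'a tvec \<Rightarrow> nat \<Rightarrow> real"
  where "chart_triv \<phi> \<equiv> \<lambda>p v i. v (\<lambda>x. \<phi> x i)"

lemma fibre_tangent_bundle [simp]: "fibre (tangent_bundle M) = tangent_space M"
  by (simp add: tangent_bundle_def)

lemma rank_tangent_bundle [simp]: "rank (tangent_bundle M) = mdim M"
  by (simp add: tangent_bundle_def)

lemma trivs_tangent_bundle:
  "trivs (tangent_bundle M) = (\<lambda>(U, \<phi>). (U, chart_triv \<phi>)) ` charts M"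
  by (simp add: tangent_bundle_def)

text \<open>The abstract frame vector, given by an inverse of the trivialisation, is the
  \<open>j\<close>-th coordinate derivative at \<open>p\<close>.\<close>

lemma frame_tangent_bundle:
  assumes c: "(U, \<phi>) \<in> charts M" "p \<in> U" and j: "j < mdim M"
  shows "frame (tangent_bundle M) (chart_triv \<phi>) j p = chart_tangent U \<phi> p (\<lambda>i. if i = j then 1 else 0)"
  unfolding frame_def fibre_tangent_bundle
proof (rule inv_into_f_eq)
  show "inj_on (chart_triv \<phi> p) (tangent_space M p)"
    using bij_betw_chart_coordinates[OF c] by (rule bij_betw_imp_inj_on)
  show "chart_tangent U \<phi> p (\<lambda>i. if i = j then 1 else 0) \<in> tangent_space M p"
    by (rule chart_tangent_in[OF c])
  show "chart_triv \<phi> p (chart_tangent U \<phi> p (\<lambda>i. if i = j then 1 else 0)) = (\<lambda>i. if i = j then 1 else 0)"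
  proof
    fix i show "chart_tangent U \<phi> p (\<lambda>i. if i = j then 1 else 0) (\<lambda>x. \<phi> x i) = (if i = j then 1 else 0)"
      using chart_tangent_coordinate[OF c] tangent_coordinate_zero[OF c chart_tangent_in[OF c]] j
      by (cases "i < mdim M") auto
  qed
qed

lemma smooth_fun_chart_partial:
  assumes c: "(U, \<phi>) \<in> charts M" and W: "openin (mtop M) W" "W \<subseteq> U" and f: "smooth_fun M W f"
    and i: "i < mdim M"
  shows "smooth_fun M W (\<lambda>p. partial i (\<lambda>x. f (inv_into U \<phi> x)) (\<phi> p))"
proof -
  let ?F = "\<lambda>x. f (inv_into U \<phi> x)"
  have "Csmooth (mdim M) (\<phi> ` W) (partial i ?F)"
    by (rule Csmooth_partial[OF iffD1[OF smooth_fun_chart[OF c W] f] i])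
  moreover have "Csmooth (mdim M) (\<phi> ` W) (partial i ?F) \<longleftrightarrow>
      Csmooth (mdim M) (\<phi> ` W) (\<lambda>x. partial i ?F (\<phi> (inv_into U \<phi> x)))"
  proof (rule Csmooth_cong[OF openin_chart_image[OF c W]])
    fix x assume "x \<in> \<phi> ` W"
    then have "\<phi> (inv_into U \<phi> x) = x" using W(2) by (intro f_inv_into_f) blast
    then show "partial i ?F x = partial i ?F (\<phi> (inv_into U \<phi> x))" by simp
  qed
  ultimately show ?thesis unfolding smooth_fun_chart[OF c W] by (rule iffD1[rotated])
qed

text \<open>These transition matrices are the Jacobian matrices of the coordinate changes, and
  partial derivatives of smooth functions are smooth.\<close>

lemma smooth_frame_coordinate:
  assumes c: "(U, \<phi>) \<in> charts M" and d: "(V, \<psi>) \<in> charts M" and j: "j < mdim M"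
  shows "smooth_fun M (U \<inter> V) (\<lambda>p. frame (tangent_bundle M) (chart_triv \<phi>) j p (\<lambda>x. \<psi> x i))"
proof -
  have W: "openin (mtop M) (U \<inter> V)" using openin_chart c d by blast
  have "frame (tangent_bundle M) (chart_triv \<phi>) j p (\<lambda>x. \<psi> x i) =
      partial j (\<lambda>x. \<psi> (inv_into U \<phi> x) i) (\<phi> p)" if p: "p \<in> U \<inter> V" for p
  proof -
    have "frame (tangent_bundle M) (chart_triv \<phi>) j p (\<lambda>x. \<psi> x i) =
      (\<Sum>l<mdim M. (if l = j then 1 else 0) * partial l (\<lambda>x. \<psi> (inv_into U \<phi> x) i) (\<phi> p))"
      using p smooth_near_coordinate[OF d, of p i]
      by (simp add: frame_tangent_bundle[OF c _ j] chart_tangent_def)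
    also have "\<dots> = partial j (\<lambda>x. \<psi> (inv_into U \<phi> x) i) (\<phi> p)"
      using j by (simp add: if_distrib[of "\<lambda>x. x * _"] cong: if_cong)
    finally show ?thesis .
  qed
  moreover have "smooth_fun M (U \<inter> V) (\<lambda>p. partial j (\<lambda>x. \<psi> (inv_into U \<phi> x) i) (\<phi> p))"
    using smooth_fun_subset[OF smooth_fun_coordinate[OF d]]
    by (intro smooth_fun_chart_partial[OF c W _ _ j]) auto
  ultimately show ?thesis by (subst smooth_fun_cong[OF W])
qed

lemma vector_bundle_tangent_bundle: "vector_bundle M (tangent_bundle M)"
proof -
  have "linear_between (tangent_space M p) (topspace (Euclidean_space (mdim M))) (chart_triv \<phi> p)"
    if "(U, \<phi>) \<in> charts M" "p \<in> U" for U \<phi> p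
    using bij_betwE[OF bij_betw_chart_coordinates[OF that]]
    unfolding linear_between_def by (auto simp: scaleR_fun_def)
  moreover have "(\<Union>(U, \<phi>)\<in>charts M. U) = topspace (mtop M)"
    using M unfolding smooth_manifold_def by blast
  moreover have "smooth_fun M (U \<inter> V) (\<lambda>p. chart_triv \<psi> p (frame (tangent_bundle M) (chart_triv \<phi>) j p) i)"
    if "(U, \<phi>) \<in> charts M" "(V, \<psi>) \<in> charts M" "j < mdim M" for U \<phi> V \<psi> i j
    by (rule smooth_frame_coordinate[OF that])
  ultimately show ?thesis
    unfolding vector_bundle_def trivs_tangent_bundle fibre_tangent_bundle rank_tangent_bundle
    using M subspace_tangent_space bij_betw_chart_coordinates openin_chart
    by (simp add: split_beta image_image) force
qed


section \<open>Vector fields\<close>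

lemma vector_fields_iff:
  "X \<in> vector_fields M \<longleftrightarrow>
    (\<forall>p\<in>topspace (mtop M). X p \<in> tangent_space M p) \<and> (\<forall>p. p \<notin> topspace (mtop M) \<longrightarrow> X p = 0) \<and>
    (\<forall>U \<phi> i. (U, \<phi>) \<in> charts M \<longrightarrow> i < mdim M \<longrightarrow> smooth_fun M U (\<lambda>p. X p (\<lambda>x. \<phi> x i)))"
  unfolding sections_def trivs_tangent_bundle by (simp add: split_beta) force

lemma vector_field_tangent:
  "X \<in> vector_fields M \<Longrightarrow> p \<in> topspace (mtop M) \<Longrightarrow> X p \<in> tangent_space M p"
  by (simp add: vector_fields_iff)

lemma vector_field_zero: "X \<in> vector_fields M \<Longrightarrow> p \<notin> topspace (mtop M) \<Longrightarrow> X p = 0"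
  by (simp add: vector_fields_iff)

lemma vector_field_not_smooth: "X \<in> vector_fields M \<Longrightarrow> \<not> smooth_near M p f \<Longrightarrow> X p f = 0"
  by (cases "p \<in> topspace (mtop M)") (auto simp: vector_field_zero dest: vector_field_tangent tangent_zero)

lemma vector_field_component:
  assumes "X \<in> vector_fields M" "(U, \<phi>) \<in> charts M" "i < mdim M"
  shows "smooth_fun M U (\<lambda>p. X p (\<lambda>x. \<phi> x i))"
  using assms(1)[unfolded vector_fields_iff] assms(2,3) by simp

text \<open>On a whole neighbourhood of \<open>p\<close> inside one chart,
  \<open>tangent_formula\<close> writes \<open>X f\<close> as a sum of components of
  \<open>X\<close> times coordinate derivatives of \<open>f\<close>, all of them smooth.\<close>

lemma smooth_near_vf_apply:
  assumes X: "X \<in> vector_fields M" and f: "smooth_near M p f"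
  shows "smooth_near M p (vf_apply X f)"
proof -
  obtain U \<phi> where c: "(U, \<phi>) \<in> charts M" "p \<in> U"
    using chart_cover[OF smooth_near_topspace[OF f]] by blast
  obtain W where W: "openin (mtop M) W" "p \<in> W" "W \<subseteq> U" "smooth_fun M W f"
    by (rule smooth_near_chart[OF c f])
  have "smooth_fun M W (\<lambda>q. \<Sum>i<mdim M. X q (\<lambda>x. \<phi> x i) * partial i (\<lambda>x. f (inv_into U \<phi> x)) (\<phi> q))"
  proof (rule smooth_fun_sum[OF W(1)])
    fix i assume "i \<in> {..<mdim M}"
    then have i: "i < mdim M" by simp
    show "smooth_fun M W (\<lambda>q. X q (\<lambda>x. \<phi> x i) * partial i (\<lambda>x. f (inv_into U \<phi> x)) (\<phi> q))"
      by (rule smooth_fun_mult[OF W(1) smooth_fun_subset[OF vector_field_component[OF X c(1) i] W(3)]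
            smooth_fun_chart_partial[OF c(1) W(1,3,4) i]])
  qed
  moreover have "vf_apply X f q =
      (\<Sum>i<mdim M. X q (\<lambda>x. \<phi> x i) * partial i (\<lambda>x. f (inv_into U \<phi> x)) (\<phi> q))" if q: "q \<in> W" for q
  proof -
    have fq: "smooth_near M q f" by (rule smooth_near_fun[OF W(4,1) q])
    have qU: "q \<in> U" using q W(3) by blast
    show ?thesis unfolding vf_apply_def
      by (rule tangent_formula[OF c(1) qU vector_field_tangent[OF X smooth_near_topspace[OF fq]] fq])
  qed
  ultimately have "smooth_fun M W (vf_apply X f)" by (subst smooth_fun_cong[OF W(1)])
  then show ?thesis by (rule smooth_near_fun[OF _ W(1,2)])
qed

text \<open>The components of \<open>X\<close> are its values on coordinate functions, which are
  smooth near every point of the chart. Together with \<open>smooth_near_vf_apply\<close> this gives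
  a chart-free test of smoothness, so brackets never have to be computed in components.\<close>

lemma vector_fieldsI:
  assumes "\<And>p. p \<in> topspace (mtop M) \<Longrightarrow> X p \<in> tangent_space M p"
    and "\<And>p. p \<notin> topspace (mtop M) \<Longrightarrow> X p = 0"
    and "\<And>p f. smooth_near M p f \<Longrightarrow> smooth_near M p (vf_apply X f)"
  shows "X \<in> vector_fields M"
  unfolding vector_fields_iff
proof (intro conjI ballI allI impI)
  fix U \<phi> i assume c: "(U, \<phi>) \<in> charts M"
  show "smooth_fun M U (\<lambda>p. X p (\<lambda>x. \<phi> x i))"
  proof (rule smooth_fun_local[OF openin_chart[OF c]])
    fix p assume "p \<in> U"
    from assms(3)[OF smooth_near_coordinate[OF c this, of i]]
    show "smooth_near M p (\<lambda>p. X p (\<lambda>x. \<phi> x i))" unfolding vf_apply_def .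
  qed
qed (use assms in auto)

section \<open>Second derivatives and the Lie bracket of vector fields\<close>

text \<open>Variant of \<open>tangent_cong\<close> for the case in which smoothness is known for the
  explicit right-hand function.\<close>

lemma tangent_cong_near:
  assumes v: "v \<in> tangent_space M p" and g: "smooth_near M p g"
    and W: "openin (mtop M) W" "p \<in> W" "\<And>q. q \<in> W \<Longrightarrow> f q = g q"
  shows "v f = v g"
  using tangent_cong[OF v g W(1,2), of f] W(3) by simp

text \<open>Since \<open>v\<close> differentiates \<open>Y f\<close>, equality is needed at all
  points near \<open>p\<close>. At each of them \<open>f\<close> is still smooth nearby, after
  shrinking to a set on which \<open>f\<close> is smooth, and still agrees with
  \<open>g\<close>.\<close>

lemma tangent_vf_cong:
  assumes v: "v \<in> tangent_space M p" and Y: "Y \<in> vector_fields M" and f: "smooth_near M p f"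
    and W: "openin (mtop M) W" "p \<in> W" "\<And>q. q \<in> W \<Longrightarrow> f q = g q"
  shows "v (vf_apply Y f) = v (vf_apply Y g)"
proof -
  obtain V where V: "openin (mtop M) V" "p \<in> V" "smooth_fun M V f"
    using f unfolding smooth_near_def by blast
  have VW: "openin (mtop M) (V \<inter> W)" "p \<in> V \<inter> W" using V W by auto
  show ?thesis
  proof (rule tangent_cong[OF v smooth_near_vf_apply[OF Y f] VW])
    fix q assume q: "q \<in> V \<inter> W"
    then have fq: "smooth_near M q f" using smooth_near_fun[OF V(3,1)] by simp
    show "vf_apply Y f q = vf_apply Y g q" unfolding vf_apply_def
      by (rule tangent_cong[OF vector_field_tangent[OF Y smooth_near_topspace[OF fq]] fq W(1)])
        (use q W in auto)
  qed
qed

lemma tangent_vf_cmult: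
  assumes v: "v \<in> tangent_space M p" and Y: "Y \<in> vector_fields M" and f: "smooth_near M p f"
  shows "v (vf_apply Y (\<lambda>x. c * f x)) = c * v (vf_apply Y f)"
proof -
  obtain W where W: "openin (mtop M) W" "p \<in> W" "smooth_fun M W f"
    using f unfolding smooth_near_def by blast
  have "v (vf_apply Y (\<lambda>x. c * f x)) = v (\<lambda>x. c * vf_apply Y f x)"
  proof (rule tangent_cong_near[OF v _ W(1,2)])
    show "smooth_near M p (\<lambda>x. c * vf_apply Y f x)"
      by (rule smooth_near_mult[OF smooth_near_const[OF smooth_near_topspace[OF f]] smooth_near_vf_apply[OF Y f]])
    fix q assume "q \<in> W"
    then have fq: "smooth_near M q f" using smooth_near_fun[OF W(3,1)] by simp
    show "vf_apply Y (\<lambda>x. c * f x) q = c * vf_apply Y f q" unfolding vf_apply_def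
      by (rule tangent_cmult[OF vector_field_tangent[OF Y smooth_near_topspace[OF fq]] fq])
  qed
  also have "\<dots> = c * v (vf_apply Y f)"
    by (rule tangent_cmult[OF v smooth_near_vf_apply[OF Y f]])
  finally show ?thesis .
qed

lemma tangent_vf_add:
  assumes v: "v \<in> tangent_space M p" and Y: "Y \<in> vector_fields M"
    and f: "smooth_near M p f" and g: "smooth_near M p g"
  shows "v (vf_apply Y (\<lambda>x. f x + g x)) = v (vf_apply Y f) + v (vf_apply Y g)"
proof -
  obtain W where W: "openin (mtop M) W" "p \<in> W" "smooth_fun M W f" "smooth_fun M W g"
    by (rule smooth_near_common[OF f g])
  have "v (vf_apply Y (\<lambda>x. f x + g x)) = v (\<lambda>x. vf_apply Y f x + vf_apply Y g x)"
  proof (rule tangent_cong_near[OF v _ W(1,2)])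
    show "smooth_near M p (\<lambda>x. vf_apply Y f x + vf_apply Y g x)"
      by (rule smooth_near_add[OF smooth_near_vf_apply[OF Y f] smooth_near_vf_apply[OF Y g]])
    fix q assume q: "q \<in> W"
    have fq: "smooth_near M q f" and gq: "smooth_near M q g"
      using smooth_near_fun[OF W(3,1) q] smooth_near_fun[OF W(4,1) q] .
    show "vf_apply Y (\<lambda>x. f x + g x) q = vf_apply Y f q + vf_apply Y g q" unfolding vf_apply_def
      by (rule tangent_add[OF vector_field_tangent[OF Y smooth_near_topspace[OF fq]] fq gq])
  qed
  also have "\<dots> = v (vf_apply Y f) + v (vf_apply Y g)"
    by (rule tangent_add[OF v smooth_near_vf_apply[OF Y f] smooth_near_vf_apply[OF Y g]])
  finally show ?thesis .
qed

text \<open>The cross terms \<open>Y p g * v f\<close> and \<open>Y p f * v g\<close> are why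
  \<open>X Y\<close> alone is no derivation. For \<open>v = X p\<close> they are interchanged when
  \<open>X\<close> and \<open>Y\<close> are swapped, so they cancel in the bracket.\<close>

lemma tangent_vf_mult:
  assumes v: "v \<in> tangent_space M p" and Y: "Y \<in> vector_fields M"
    and f: "smooth_near M p f" and g: "smooth_near M p g"
  shows "v (vf_apply Y (\<lambda>x. f x * g x)) =
    (f p * v (vf_apply Y g) + Y p g * v f) + (g p * v (vf_apply Y f) + Y p f * v g)"
proof -
  obtain W where W: "openin (mtop M) W" "p \<in> W" "smooth_fun M W f" "smooth_fun M W g"
    by (rule smooth_near_common[OF f g])
  note Yf = smooth_near_vf_apply[OF Y f] and Yg = smooth_near_vf_apply[OF Y g]
  note fYg = smooth_near_mult[OF f Yg] and gYf = smooth_near_mult[OF g Yf]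
  have "v (vf_apply Y (\<lambda>x. f x * g x)) = v (\<lambda>x. f x * vf_apply Y g x + g x * vf_apply Y f x)"
  proof (rule tangent_cong_near[OF v smooth_near_add[OF fYg gYf] W(1,2)])
    fix q assume q: "q \<in> W"
    have fq: "smooth_near M q f" and gq: "smooth_near M q g"
      using smooth_near_fun[OF W(3,1) q] smooth_near_fun[OF W(4,1) q] .
    show "vf_apply Y (\<lambda>x. f x * g x) q = f q * vf_apply Y g q + g q * vf_apply Y f q"
      unfolding vf_apply_def
      by (rule tangent_mult[OF vector_field_tangent[OF Y smooth_near_topspace[OF fq]] fq gq])
  qed
  also have "\<dots> = v (\<lambda>x. f x * vf_apply Y g x) + v (\<lambda>x. g x * vf_apply Y f x)"
    by (rule tangent_add[OF v fYg gYf])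
  also have "v (\<lambda>x. f x * vf_apply Y g x) = f p * v (vf_apply Y g) + vf_apply Y g p * v f"
    by (rule tangent_mult[OF v f Yg])
  also have "v (\<lambda>x. g x * vf_apply Y f x) = g p * v (vf_apply Y f) + vf_apply Y f p * v g"
    by (rule tangent_mult[OF v g Yf])
  finally show ?thesis unfolding vf_apply_def .
qed

lemma vf_bracket_smooth:
  "smooth_near M p f \<Longrightarrow> vf_bracket M X Y p f = X p (vf_apply Y f) - Y p (vf_apply X f)"
  by (simp add: vf_bracket_def)

lemma vf_bracket_tangent:
  assumes X: "X \<in> vector_fields M" and Y: "Y \<in> vector_fields M" and p: "p \<in> topspace (mtop M)"
  shows "vf_bracket M X Y p \<in> tangent_space M p"
proof (rule tangent_spaceI)
  note x = vector_field_tangent[OF X p] and y = vector_field_tangent[OF Y p]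
  have pM: "smooth_near M p (\<lambda>x. c)" for c by (rule smooth_near_const[OF p])
  show "vf_bracket M X Y p f = 0" if "\<not> smooth_near M p f" for f
    using that by (simp add: vf_bracket_def)
  show "vf_bracket M X Y p f = vf_bracket M X Y p g"
    if f: "smooth_near M p f" and W: "openin (mtop M) W" "p \<in> W" "\<And>x. x \<in> W \<Longrightarrow> f x = g x" for f g W
  proof -
    have g: "smooth_near M p g" by (rule smooth_near_cong[OF f W])
    have "X p (vf_apply Y f) = X p (vf_apply Y g)" by (rule tangent_vf_cong[OF x Y f W])
    moreover have "Y p (vf_apply X f) = Y p (vf_apply X g)" by (rule tangent_vf_cong[OF y X f W])
    ultimately show ?thesis unfolding vf_bracket_smooth[OF f] vf_bracket_smooth[OF g] by simp
  qed
  show "vf_bracket M X Y p (\<lambda>x. c * f x) = c * vf_bracket M X Y p f" if f: "smooth_near M p f" for c f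
    unfolding vf_bracket_smooth[OF f] vf_bracket_smooth[OF smooth_near_mult[OF pM f]]
      tangent_vf_cmult[OF x Y f] tangent_vf_cmult[OF y X f] by (rule right_diff_distrib[symmetric])
  show "vf_bracket M X Y p (\<lambda>x. f x + g x) = vf_bracket M X Y p f + vf_bracket M X Y p g"
    if f: "smooth_near M p f" and g: "smooth_near M p g" for f g
    unfolding vf_bracket_smooth[OF f] vf_bracket_smooth[OF g] vf_bracket_smooth[OF smooth_near_add[OF f g]]
      tangent_vf_add[OF x Y f g] tangent_vf_add[OF y X f g] by simp
  show "vf_bracket M X Y p (\<lambda>x. f x * g x) = f p * vf_bracket M X Y p g + g p * vf_bracket M X Y p f"
    if f: "smooth_near M p f" and g: "smooth_near M p g" for f g
    unfolding vf_bracket_smooth[OF f] vf_bracket_smooth[OF g] vf_bracket_smooth[OF smooth_near_mult[OF f g]]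
      tangent_vf_mult[OF x Y f g] tangent_vf_mult[OF y X f g] by (simp add: algebra_simps)
qed

text \<open>The guard in \<open>vf_bracket\<close> restricts the commutator formula to points near
  which \<open>f\<close> is smooth; these fill a neighbourhood of \<open>p\<close>, so the formula
  can be differentiated again.\<close>

lemma vf_apply_bracket_near:
  assumes f: "smooth_near M p f"
  obtains W where "openin (mtop M) W" "p \<in> W"
    "\<forall>q\<in>W. vf_apply (vf_bracket M X Y) f q =
      vf_apply X (vf_apply Y f) q - vf_apply Y (vf_apply X f) q"
proof -
  obtain W where W: "openin (mtop M) W" "p \<in> W" "smooth_fun M W f"
    using f unfolding smooth_near_def by blast
  show ?thesis
    by (rule that[OF W(1,2)], rule ballI, subst (1 2 3) vf_apply_def)
      (rule vf_bracket_smooth[OF smooth_near_fun[OF W(3,1)]])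
qed

lemma vf_bracket_in:
  assumes X: "X \<in> vector_fields M" and Y: "Y \<in> vector_fields M"
  shows "vf_bracket M X Y \<in> vector_fields M"
proof (rule vector_fieldsI)
  show "vf_bracket M X Y p = 0" if "p \<notin> topspace (mtop M)" for p
    using that smooth_near_topspace[of p] by (intro ext) (auto simp: vf_bracket_def)
  show "smooth_near M p (vf_apply (vf_bracket M X Y) f)" if f: "smooth_near M p f" for p f
  proof -
    obtain W where W: "openin (mtop M) W" "p \<in> W"
      "\<forall>q\<in>W. vf_apply (vf_bracket M X Y) f q =
        vf_apply X (vf_apply Y f) q - vf_apply Y (vf_apply X f) q"
      by (rule vf_apply_bracket_near[where X=X and Y=Y, OF f])
    show ?thesis
      by (rule smooth_near_cong[OF _ W(1,2) W(3)[THEN bspec, symmetric]])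
        (rule smooth_near_diff[OF smooth_near_vf_apply[OF X smooth_near_vf_apply[OF Y f]]
            smooth_near_vf_apply[OF Y smooth_near_vf_apply[OF X f]]])
  qed
qed (rule vf_bracket_tangent[OF X Y])

lemma tangent_vf_bracket:
  assumes v: "v \<in> tangent_space M p" and X: "X \<in> vector_fields M" and Y: "Y \<in> vector_fields M"
    and f: "smooth_near M p f"
  shows "v (vf_apply (vf_bracket M X Y) f) = v (vf_apply X (vf_apply Y f)) - v (vf_apply Y (vf_apply X f))"
proof -
  obtain W where W: "openin (mtop M) W" "p \<in> W"
    "\<forall>q\<in>W. vf_apply (vf_bracket M X Y) f q =
      vf_apply X (vf_apply Y f) q - vf_apply Y (vf_apply X f) q"
    by (rule vf_apply_bracket_near[where X=X and Y=Y, OF f])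
  note XY = smooth_near_vf_apply[OF X smooth_near_vf_apply[OF Y f]]
    and YX = smooth_near_vf_apply[OF Y smooth_near_vf_apply[OF X f]]
  have "v (vf_apply (vf_bracket M X Y) f) =
      v (\<lambda>q. vf_apply X (vf_apply Y f) q - vf_apply Y (vf_apply X f) q)"
    by (rule tangent_cong_near[OF v smooth_near_diff[OF XY YX] W(1,2) W(3)[THEN bspec]])
  also have "\<dots> = v (vf_apply X (vf_apply Y f)) - v (vf_apply Y (vf_apply X f))"
    by (rule tangent_diff[OF v XY YX])
  finally show ?thesis .
qed

text \<open>Each double bracket becomes four third-order derivatives of \<open>f\<close> at
  \<open>p\<close>, and the twelve terms of the cyclic sum cancel in pairs.\<close>

lemma vf_bracket_jacobi:
  assumes X: "X \<in> vector_fields M" and Y: "Y \<in> vector_fields M" and Z: "Z \<in> vector_fields M"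
  shows "vf_bracket M X (vf_bracket M Y Z) + vf_bracket M Y (vf_bracket M Z X) +
    vf_bracket M Z (vf_bracket M X Y) = 0"
proof (intro ext)
  fix p f
  show "(vf_bracket M X (vf_bracket M Y Z) + vf_bracket M Y (vf_bracket M Z X) +
    vf_bracket M Z (vf_bracket M X Y)) p f = 0 p f"
  proof (cases "smooth_near M p f")
    case f: True
    have *: "vf_bracket M A (vf_bracket M B C) p f =
        (A p (vf_apply B (vf_apply C f)) - A p (vf_apply C (vf_apply B f))) -
        (B p (vf_apply C (vf_apply A f)) - C p (vf_apply B (vf_apply A f)))"
      if A: "A \<in> vector_fields M" and B: "B \<in> vector_fields M" and C: "C \<in> vector_fields M" for A B C
      unfolding vf_bracket_smooth[OF f] vf_bracket_smooth[OF smooth_near_vf_apply[OF A f]]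
        tangent_vf_bracket[OF vector_field_tangent[OF A smooth_near_topspace[OF f]] B C f] ..
    show ?thesis using *[OF X Y Z] *[OF Y Z X] *[OF Z X Y] by simp
  qed (simp add: vf_bracket_def)
qed

section \<open>Vector fields as a module over functions and as a Lie algebra\<close>

lemma fun_scale_in:
  assumes f: "smooth_fun M (topspace (mtop M)) f" and X: "X \<in> vector_fields M"
  shows "fun_scale f X \<in> vector_fields M"
proof (rule vector_fieldsI)
  show "fun_scale f X p \<in> tangent_space M p" if "p \<in> topspace (mtop M)" for p
    unfolding fun_scale_def by (rule subspace_scale[OF subspace_tangent_space vector_field_tangent[OF X that]])
  show "fun_scale f X p = 0" if "p \<notin> topspace (mtop M)" for p
    unfolding fun_scale_def vector_field_zero[OF X that] by (rule scaleR_zero_right)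
  show "smooth_near M p (vf_apply (fun_scale f X) g)" if g: "smooth_near M p g" for p g
  proof -
    have "vf_apply (fun_scale f X) g = (\<lambda>q. f q * vf_apply X g q)"
      by (simp add: vf_apply_def fun_scale_def scaleR_fun_def)
    moreover have "smooth_near M p f"
      by (rule smooth_near_fun[OF f openin_topspace smooth_near_topspace[OF g]])
    ultimately show ?thesis using smooth_near_mult[OF _ smooth_near_vf_apply[OF X g]] by simp
  qed
qed

lemma subspace_vector_fields: "subspace (vector_fields M)"
proof -
  have "(0 :: 'a \<Rightarrow> 'a tvec) \<in> vector_fields M"
  proof (rule vector_fieldsI)
    show "(0 :: 'a \<Rightarrow> 'a tvec) p \<in> tangent_space M p" for p
      using subspace_0[OF subspace_tangent_space, of p] by (simp add: zero_fun_def)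
    show "smooth_near M p (vf_apply 0 f)" if "smooth_near M p f" for p f
      using smooth_near_const[OF smooth_near_topspace[OF that]] by (simp add: vf_apply_def)
  qed simp
  moreover have "X + Y \<in> vector_fields M"
    if X: "X \<in> vector_fields M" and Y: "Y \<in> vector_fields M" for X Y
  proof (rule vector_fieldsI)
    show "(X + Y) p \<in> tangent_space M p" if "p \<in> topspace (mtop M)" for p
      using subspace_add[OF subspace_tangent_space vector_field_tangent[OF X that] vector_field_tangent[OF Y that]]
      by (simp add: plus_fun_def)
    show "(X + Y) p = 0" if "p \<notin> topspace (mtop M)" for p
      by (simp add: vector_field_zero[OF X that] vector_field_zero[OF Y that])
    show "smooth_near M p (vf_apply (X + Y) f)" if f: "smooth_near M p f" for p f
      using smooth_near_add[OF smooth_near_vf_apply[OF X f] smooth_near_vf_apply[OF Y f]]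
      by (simp add: vf_apply_def)
  qed
  moreover have "c *\<^sub>R X \<in> vector_fields M" if "X \<in> vector_fields M" for c X
    using fun_scale_in[OF smooth_fun_const[OF openin_topspace] that, of c]
    by (simp add: fun_scale_def scaleR_fun_def)
  ultimately show ?thesis unfolding subspace_def by blast
qed

lemma vf_bracket_anticommute: "vf_bracket M Y X = - vf_bracket M X Y"
  by (intro ext) (simp add: vf_bracket_def)

lemma vf_bracket_add_left:
  assumes X: "X \<in> vector_fields M" and Y: "Y \<in> vector_fields M" and Z: "Z \<in> vector_fields M"
  shows "vf_bracket M (X + Y) Z = vf_bracket M X Z + vf_bracket M Y Z"
proof (intro ext)
  fix p f
  show "vf_bracket M (X + Y) Z p f = (vf_bracket M X Z + vf_bracket M Y Z) p f"
  proof (cases "smooth_near M p f")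
    case f: True
    have "vf_apply (X + Y) f = (\<lambda>q. vf_apply X f q + vf_apply Y f q)"
      by (simp add: vf_apply_def)
    then have "Z p (vf_apply (X + Y) f) = Z p (vf_apply X f) + Z p (vf_apply Y f)"
      using tangent_add[OF vector_field_tangent[OF Z smooth_near_topspace[OF f]]
          smooth_near_vf_apply[OF X f] smooth_near_vf_apply[OF Y f]] by simp
    then show ?thesis by (simp add: vf_bracket_smooth[OF f])
  qed (simp add: vf_bracket_def)
qed

lemma vf_bracket_fun_scale_right:
  assumes X: "X \<in> vector_fields M" and Y: "Y \<in> vector_fields M"
    and f: "smooth_fun M (topspace (mtop M)) f"
  shows "vf_bracket M X (fun_scale f Y) = fun_scale f (vf_bracket M X Y) + fun_scale (vf_apply X f) Y"
proof (intro ext)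
  fix p g
  show "vf_bracket M X (fun_scale f Y) p g =
      (fun_scale f (vf_bracket M X Y) + fun_scale (vf_apply X f) Y) p g"
  proof (cases "smooth_near M p g")
    case g: True
    note pM = smooth_near_topspace[OF g]
    have "vf_apply (fun_scale f Y) g = (\<lambda>q. f q * vf_apply Y g q)"
      by (simp add: vf_apply_def fun_scale_def scaleR_fun_def)
    then have "X p (vf_apply (fun_scale f Y) g) = f p * X p (vf_apply Y g) + vf_apply Y g p * X p f"
      using tangent_mult[OF vector_field_tangent[OF X pM] smooth_near_fun[OF f openin_topspace pM]
          smooth_near_vf_apply[OF Y g]] by simp
    then show ?thesis
      by (simp add: vf_bracket_smooth[OF g] fun_scale_def scaleR_fun_def vf_apply_def algebra_simps)
  \<comment> \<open>If \<open>g\<close> is not smooth near \<open>p\<close>, the guard makes both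
    brackets 0, and \<open>Y p g = 0\<close> by the convention on tangent vectors.\<close>
  qed (simp add: vf_bracket_def fun_scale_def scaleR_fun_def vector_field_not_smooth[OF Y])
qed

lemma lie_bracket_on_vf_bracket: "lie_bracket_on (vector_fields M) (vf_bracket M)"
proof -
  have add_right: "vf_bracket M Z (X + Y) = vf_bracket M Z X + vf_bracket M Z Y"
    if "X \<in> vector_fields M" "Y \<in> vector_fields M" "Z \<in> vector_fields M" for X Y Z
    using vf_bracket_add_left[OF that] vf_bracket_anticommute[of Z X] vf_bracket_anticommute[of Z Y]
      vf_bracket_anticommute[of Z "X + Y"] by simp
  have scale_right: "vf_bracket M X (c *\<^sub>R Y) = c *\<^sub>R vf_bracket M X Y"
    if X: "X \<in> vector_fields M" and Y: "Y \<in> vector_fields M" for c X Y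
  proof -
    \<comment> \<open>Real scaling is the Leibniz rule for a constant function, whose derivative
      vanishes.\<close>
    have "X p (\<lambda>x. c) = 0" for p
      using tangent_const[OF vector_field_tangent[OF X]] vector_field_zero[OF X]
      by (cases "p \<in> topspace (mtop M)") auto
    then show ?thesis
      using vf_bracket_fun_scale_right[OF X Y smooth_fun_const[OF openin_topspace], of c]
      by (simp add: fun_scale_def vf_apply_def scaleR_fun_def plus_fun_def)
  qed
  have scale_left: "vf_bracket M (c *\<^sub>R X) Y = c *\<^sub>R vf_bracket M X Y"
    if X: "X \<in> vector_fields M" and Y: "Y \<in> vector_fields M" for c X Y
    using scale_right[OF Y X, of c] vf_bracket_anticommute[of Y X] vf_bracket_anticommute[of Y "c *\<^sub>R X"]
    by simp
  have self: "vf_bracket M X X = 0" for X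
    by (intro ext) (simp add: vf_bracket_def)
  show ?thesis
    unfolding lie_bracket_on_def
    by (intro conjI ballI allI vf_bracket_in vf_bracket_add_left add_right scale_left scale_right self
        vf_bracket_jacobi)
qed

section \<open>Bundle endomorphisms acting on vector fields\<close>

lemma linear_between_sum:
  assumes L: "linear_between V W L" and V: "subspace V" and "\<And>j. j \<in> J \<Longrightarrow> u j \<in> V"
  shows "L (\<Sum>j\<in>J. a j *\<^sub>R u j) = (\<Sum>j\<in>J. a j *\<^sub>R L (u j))"
proof -
  have add: "L (v + w) = L v + L w" if "v \<in> V" "w \<in> V" for v w
    using L that unfolding linear_between_def by simp
  have scale: "L (c *\<^sub>R v) = c *\<^sub>R L v" if "v \<in> V" for c v
    using L that unfolding linear_between_def by simp
  have "L 0 = 0" using scale[OF subspace_0[OF V], of 0] by simp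
  with assms(3) show ?thesis
    by (induction J rule: infinite_finite_induct)
      (simp_all add: add scale subspace_scale[OF V] subspace_sum[OF V])
qed

lemma sum_scaleR_fun_apply: "(\<Sum>j\<in>J. a j *\<^sub>R u j) x = (\<Sum>j\<in>J. a j *\<^sub>R u j x)"
  by (induction J rule: infinite_finite_induct) (simp_all add: scaleR_fun_def)

lemma tangent_frame_expansion:
  assumes c: "(U, \<phi>) \<in> charts M" "p \<in> U" and v: "v \<in> tangent_space M p"
  shows "v = (\<Sum>j<mdim M. v (\<lambda>x. \<phi> x j) *\<^sub>R frame (tangent_bundle M) (chart_triv \<phi>) j p)" (is "v = ?w")
proof (rule tangent_eqI[OF c v])
  show "?w \<in> tangent_space M p"
    by (intro subspace_sum[OF subspace_tangent_space] subspace_scale[OF subspace_tangent_space])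
      (simp add: frame_tangent_bundle[OF c] chart_tangent_in[OF c])
  fix i assume i: "i < mdim M"
  have "?w (\<lambda>x. \<phi> x i) = (\<Sum>j<mdim M. v (\<lambda>x. \<phi> x j) * (if i = j then 1 else 0))"
    unfolding sum_scaleR_fun_apply
    by (rule sum.cong[OF refl]) (simp add: frame_tangent_bundle[OF c] chart_tangent_coordinate[OF c i])
  also have "\<dots> = v (\<lambda>x. \<phi> x i)" using i by (simp add: if_distrib cong: if_cong)
  finally show "v (\<lambda>x. \<phi> x i) = ?w (\<lambda>x. \<phi> x i)" by simp
qed

text \<open>With the same chart on both sides, the components of \<open>N X\<close> are the matrix
  entries of \<open>N\<close> in the coordinate frame times the components of \<open>X\<close>,
  hence smooth.\<close>

lemma app_section_in:
  assumes N: "bundle_map M (tangent_bundle M) (tangent_bundle M) N" and X: "X \<in> vector_fields M"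
  shows "app_section M N X \<in> vector_fields M"
proof -
  have lin: "linear_between (tangent_space M p) (tangent_space M p) (N p)" if "p \<in> topspace (mtop M)" for p
    using N that unfolding bundle_map_def by simp
  have smooth: "smooth_fun M U (\<lambda>p. N p (frame (tangent_bundle M) (chart_triv \<phi>) j p) (\<lambda>x. \<phi> x i))"
    if "(U, \<phi>) \<in> charts M" "i < mdim M" "j < mdim M" for U \<phi> i j
  proof -
    have "(U, chart_triv \<phi>) \<in> trivs (tangent_bundle M)"
      unfolding trivs_tangent_bundle by (rule image_eqI[OF _ that(1)]) simp
    moreover have "\<forall>(U, \<Phi>)\<in>trivs (tangent_bundle M). \<forall>(V, \<Psi>)\<in>trivs (tangent_bundle M).
        \<forall>i<mdim M. \<forall>j<mdim M.
          smooth_fun M (U \<inter> V) (\<lambda>p. \<Psi> p (N p (frame (tangent_bundle M) \<Phi> j p)) i)"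
      using N unfolding bundle_map_def rank_tangent_bundle by (rule conjunct2)
    ultimately have "smooth_fun M (U \<inter> U) (\<lambda>p. chart_triv \<phi> p (N p (frame (tangent_bundle M) (chart_triv \<phi>) j p)) i)"
      using that(2,3) by fastforce
    then show ?thesis by simp
  qed
  show ?thesis
    unfolding vector_fields_iff
  proof (intro conjI ballI allI impI)
    fix p assume p: "p \<in> topspace (mtop M)"
    then show "app_section M N X p \<in> tangent_space M p"
      using lin[OF p] vector_field_tangent[OF X p] by (simp add: app_section_def linear_between_def)
  next
    fix p assume "p \<notin> topspace (mtop M)"
    then show "app_section M N X p = 0" by (simp add: app_section_def)
  next
    fix U \<phi> i assume c: "(U, \<phi>) \<in> charts M" and i: "i < mdim M"
    have "app_section M N X p (\<lambda>x. \<phi> x i) = (\<Sum>j<mdim M. X p (\<lambda>x. \<phi> x j) *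
        N p (frame (tangent_bundle M) (chart_triv \<phi>) j p) (\<lambda>x. \<phi> x i))" if p: "p \<in> U" for p
    proof -
      have pM: "p \<in> topspace (mtop M)" using openin_subset[OF openin_chart[OF c]] p by blast
      have "app_section M N X p = N p (X p)" using pM by (simp add: app_section_def)
      also have "\<dots> = N p (\<Sum>j<mdim M. X p (\<lambda>x. \<phi> x j) *\<^sub>R frame (tangent_bundle M) (chart_triv \<phi>) j p)"
        by (rule arg_cong[OF tangent_frame_expansion[OF c p vector_field_tangent[OF X pM]]])
      also have "\<dots> = (\<Sum>j<mdim M. X p (\<lambda>x. \<phi> x j) *\<^sub>R N p (frame (tangent_bundle M) (chart_triv \<phi>) j p))"
        by (rule linear_between_sum[OF lin[OF pM] subspace_tangent_space])
          (simp add: frame_tangent_bundle[OF c p] chart_tangent_in[OF c p])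
      finally show ?thesis by (simp add: sum_scaleR_fun_apply)
    qed
    moreover have "smooth_fun M U (\<lambda>p. \<Sum>j<mdim M. X p (\<lambda>x. \<phi> x j) *
        N p (frame (tangent_bundle M) (chart_triv \<phi>) j p) (\<lambda>x. \<phi> x i))"
    proof (rule smooth_fun_sum[OF openin_chart[OF c]])
      fix j assume "j \<in> {..<mdim M}"
      then have j: "j < mdim M" by simp
      show "smooth_fun M U (\<lambda>p. X p (\<lambda>x. \<phi> x j) *
          N p (frame (tangent_bundle M) (chart_triv \<phi>) j p) (\<lambda>x. \<phi> x i))"
        by (rule smooth_fun_mult[OF openin_chart[OF c] vector_field_component[OF X c j] smooth[OF c i j]])
    qed
    ultimately show "smooth_fun M U (\<lambda>p. app_section M N X p (\<lambda>x. \<phi> x i))"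
      by (subst smooth_fun_cong[OF openin_chart[OF c]])
  qed
qed

end

section \<open>Assembling the Lie algebroid on the tangent bundle\<close>

theorem theorem5p5:
  fixes M :: "'a manifold" and N :: "'a \<Rightarrow> 'a tvec \<Rightarrow> 'a tvec"
  assumes "smooth_manifold M" and "connected_space (mtop M)"
    and "bundle_map M (tangent_bundle M) (tangent_bundle M) N"
    and "\<forall>p\<in>topspace (mtop M). \<forall>v\<in>tangent_space M p. N p (N p v) = N p v"
    and "involutive_image M N"
  shows "lie_algebroid M (tangent_bundle M) N
    (\<lambda>X Y. contracted_bracket M N X Y + nijenhuis_torsion M N X Y)"
proof -
  interpret smooth_mfd M by unfold_locales (rule assms(1))
  let ?P = "app_section M N" and ?b = "vf_bracket M"
  have N_linear: "linear_between (tangent_space M p) (tangent_space M p) (N p)" if "p \<in> topspace (mtop M)" for p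
    using assms(3) that unfolding bundle_map_def by simp
  note P_in = app_section_in[OF assms(3)]
  interpret split_lie_algebra "vector_fields M" ?b ?P
  proof
    show "linear_between (vector_fields M) (vector_fields M) ?P"
      unfolding linear_between_def
    proof (intro conjI ballI allI)
      fix X Y assume X: "X \<in> vector_fields M" and Y: "Y \<in> vector_fields M"
      show "?P (X + Y) = ?P X + ?P Y"
        using N_linear vector_field_tangent[OF X] vector_field_tangent[OF Y]
        by (intro ext) (simp add: app_section_def linear_between_def)
    next
      fix c X assume X: "X \<in> vector_fields M"
      show "?P (c *\<^sub>R X) = c *\<^sub>R ?P X"
      proof
        fix p show "?P (c *\<^sub>R X) p = (c *\<^sub>R ?P X) p"
          using N_linear[of p] vector_field_tangent[OF X, of p]
          unfolding scaleR_fun_def[of c X] scaleR_fun_def[of c "?P X"]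
          by (simp add: app_section_def linear_between_def)
      qed
    qed (rule P_in)
    show "?P (?P X) = ?P X" if X: "X \<in> vector_fields M" for X
      using assms(4) vector_field_tangent[OF X] by (intro ext) (simp add: app_section_def)
    show "?P (?b (?P X) (?P Y)) = ?b (?P X) (?P Y)"
      if X: "X \<in> vector_fields M" and Y: "Y \<in> vector_fields M" for X Y
    proof
      fix p
      show "?P (?b (?P X) (?P Y)) p = ?b (?P X) (?P Y) p"
      proof (cases "p \<in> topspace (mtop M)")
        case p: True
        have "?b (?P X) (?P Y) p \<in> N p ` tangent_space M p"
          using assms(5) X Y p unfolding involutive_image_def by simp
        \<comment> \<open>The hypothesis is pointwise: the bracket at \<open>p\<close> is some
          \<open>N p w\<close>, and \<open>N p\<close> fixes such vectors by idempotence. No vector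
          field extending \<open>w\<close> is constructed.\<close>
        then obtain w where "w \<in> tangent_space M p" "?b (?P X) (?P Y) p = N p w" by blast
        then show ?thesis using assms(4) p by (simp add: app_section_def)
      next
        case False
        then show ?thesis
          using vector_field_zero[OF vf_bracket_in[OF P_in[OF X] P_in[OF Y]] False]
          by (simp add: app_section_def)
      qed
    qed
  qed (rule lie_bracket_on_vf_bracket subspace_vector_fields)+
  have br: "(\<lambda>X Y. contracted_bracket M N X Y + nijenhuis_torsion M N X Y) = br"
    unfolding contracted_bracket_def nijenhuis_torsion_def br_def ..
  have P_fun_scale: "?P (fun_scale f X) = fun_scale f (?P X)" if X: "X \<in> vector_fields M" for f X
  proof
    fix p show "?P (fun_scale f X) p = fun_scale f (?P X) p"
      using N_linear[of p] vector_field_tangent[OF X, of p]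
      by (simp add: app_section_def linear_between_def fun_scale_def)
  qed
  have "br A (fun_scale f B) = fun_scale f (br A B) + fun_scale (vf_apply (?P A) f) B"
    if A: "A \<in> vector_fields M" and B: "B \<in> vector_fields M"
      and f: "smooth_fun M (topspace (mtop M)) f" for A B f
  proof -
    let ?s = "fun_scale f" and ?a = "fun_scale (vf_apply A f)" and ?n = "fun_scale (vf_apply (?P A) f)"
    \<comment> \<open>Idempotence removes the two terms in \<open>P (b X Y)\<close>, leaving five
      terms to which the Leibniz rule is applied separately.\<close>
    have br': "br X Y = ?b (?P X) Y + ?b X (?P Y) + ?b (?P X) (?P Y) - ?P (?b (?P X) Y) - ?P (?b X (?P Y))"
      if "X \<in> vector_fields M" "Y \<in> vector_fields M" for X Y
      unfolding br_def using idem[OF b_in[OF that]] by simp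
    note PA = P_in[OF A] and PB = P_in[OF B]
    \<comment> \<open>The Leibniz rule for the vector field bracket yields sums of scaled fields.
      The linearity fact below treats them fibre by fibre, so the coefficient \<open>g\<close> may
      be any function, in particular \<open>vf_apply A f\<close>.\<close>
    note leib = vf_bracket_fun_scale_right
    have sum_P: "?P (?s X + fun_scale g Y) = ?s (?P X) + fun_scale g (?P Y)"
      if "X \<in> vector_fields M" "Y \<in> vector_fields M" for X Y g
    proof
      fix p show "?P (?s X + fun_scale g Y) p = (?s (?P X) + fun_scale g (?P Y)) p"
        using N_linear[of p] vector_field_tangent[OF that(1), of p] vector_field_tangent[OF that(2), of p]
          subspace_scale[OF subspace_tangent_space]
        by (simp add: app_section_def linear_between_def fun_scale_def)
    qed
    \<comment> \<open>Of the five terms with a derivative of \<open>f\<close>, the two in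
      \<open>?n (?P B)\<close> cancel and so do the two in \<open>?a (?P B)\<close>, the last after
      \<open>P (P B) = P B\<close>. What remains is \<open>?n B\<close>, the anchor term.\<close>
    have "br A (?s B) = (?s (?b (?P A) B) + ?n B) + (?s (?b A (?P B)) + ?a (?P B)) +
        (?s (?b (?P A) (?P B)) + ?n (?P B)) -
        (?s (?P (?b (?P A) B)) + ?n (?P B)) - (?s (?P (?b A (?P B))) + ?a (?P B))"
      unfolding br'[OF A fun_scale_in[OF f B]] P_fun_scale[OF B] leib[OF PA B f] leib[OF A PB f]
        leib[OF PA PB f] sum_P[OF b_in[OF PA B] B] sum_P[OF b_in[OF A PB] PB] idem[OF B] ..
    also have "\<dots> = ?s (br A B) + ?n B"
      unfolding br'[OF A B] by (intro ext) (simp add: fun_scale_def scaleR_fun_def algebra_simps)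
    finally show ?thesis .
  qed
  then show ?thesis
    unfolding lie_algebroid_def br
    using vector_bundle_tangent_bundle assms(3) lie_bracket_on_br by simp
qed

end
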